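(* Let $f:\mathbb{R}^n\to[0,\infty)$ be an integrable log-concave function, and let $g=e^{-\varphi}:\mathbb{R}^n\to[0,\infty)$ be an integrable log-concave function whose support is all of $\mathbb{R}^n$ and which satisfies $\int_{\mathbb{R}^n}|\nabla g(x)|^2\,dx<\infty$. (a) There exists a pair $(T_0,z_0)\in \mathrm{SL}_n(\mathbb{R})\times\mathbb{R}^n$ at which the supremum $$m_{f,g}=\sup\left\{\int_{\mathbb{R}^n}f(x)\,g(T^{-1}(x-z))\,dx:\ (T,z)\in \mathrm{SL}_n(\mathbb{R})\times\mathbb{R}^n\right\}$$ is attained. (b) If $f$ and $g$ are in maximal intersection position, then $$C_{f,g}\,I_n=\int_{\mathbb{R}^n}\big(\nabla\varphi(x)\otimes x\big)\,f(x)g(x)\,dx \qquad\text{and}\qquad o=\int_{\mathrm{supp}(f)}f(x)g(x)\,\nabla\varphi(x)\,dx,$$ where $$C_{f,g}:=\frac1n\int_{\mathrm{supp}(f)}\langle\nabla\varphi(x),x\rangle f(x)g(x)\,dx.$$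
   Context: $n\ge 1$; $\mathbb{R}^n$ carries the standard inner product $\langle\cdot,\cdot\rangle$ and Euclidean norm $|\cdot|$; $o$ is the origin and $I_n$ the $n\times n$ identity matrix. A function $\mathbb{R}^n\to[0,\infty)$ is log-concave if it has the form $e^{-\varphi}$ with $\varphi:\mathbb{R}^n\to(-\infty,\infty]$ convex (convention $e^{-\infty}=0$). The support of $h$ is $\mathrm{supp}(h)=\overline{\{x\in\mathbb{R}^n:h(x)\ne0\}}$. Gradients of convex and log-concave functions exist almost everywhere on the interior of their domains/supports. For $x,y\in\mathbb{R}^n$, $x\otimes y$ is the linear map $(x\otimes y)(z)=\langle z,y\rangle x$. Two integrable log-concave functions $f,g$ on $\mathbb{R}^n$ are in maximal intersection position if $(T,z)=(I_n,o)$ attains the supremum $\sup\{\int_{\mathbb{R}^n}f(x)g(T^{-1}(x-z))\,dx:(T,z)\in \mathrm{SL}_n(\mathbb{R})\times\mathbb{R}^n\}$. *)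

theory Defs
  imports "HOL-Analysis.Analysis"
begin

text \<open>
  Extended-valued convex functions \<open>\<real>\<^sup>n \<rightarrow> (-\<infinity>, \<infinity>]\<close>. The library's \<open>convex_on\<close> only covers real values;
  in \<open>ereal\<close> we have \<open>0 * \<infinity> = 0\<close>, so the inequality is also correct for \<open>u = 0\<close> and \<open>u = 1\<close>.
\<close>

definition convex_ereal :: "('a::real_vector \<Rightarrow> ereal) \<Rightarrow> bool" where
  "convex_ereal \<phi> \<longleftrightarrow>
     (\<forall>x. \<phi> x \<noteq> -\<infinity>) \<and>
     (\<forall>x y u v. 0 \<le> u \<longrightarrow> 0 \<le> v \<longrightarrow> u + v = 1 \<longrightarrow>
        \<phi> (u *\<^sub>R x + v *\<^sub>R y) \<le> ereal u * \<phi> x + ereal v * \<phi> y)"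

definition exp_neg :: "ereal \<Rightarrow> real" where
  "exp_neg t = (if t = \<infinity> then 0 else exp (- real_of_ereal t))"

definition log_concave :: "('a::real_vector \<Rightarrow> real) \<Rightarrow> bool" where
  "log_concave h \<longleftrightarrow> (\<exists>\<phi>. convex_ereal \<phi> \<and> h = (\<lambda>x. exp_neg (\<phi> x)))"

definition supp :: "('a::topological_space \<Rightarrow> real) \<Rightarrow> 'a set" where
  "supp h = closure {x. h x \<noteq> 0}"

text \<open>
  Where \<open>h\<close> is not differentiable the value is one fixed unspecified vector. The gradient is only
  used for functions that are differentiable almost everywhere, and only under an integral sign.
\<close>

definition gradient :: "('a::euclidean_space \<Rightarrow> real) \<Rightarrow> 'a \<Rightarrow> 'a" where
  "gradient h x = (THE D. GDERIV h x :> D)"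

text \<open>
  Extended-valued functions are differentiated through \<open>real_of_ereal\<close>, which does not change them
  in the interior of their domain.
\<close>

definition gradient_ereal :: "('a::euclidean_space \<Rightarrow> ereal) \<Rightarrow> 'a \<Rightarrow> 'a" where
  "gradient_ereal \<phi> = gradient (\<lambda>x. real_of_ereal (\<phi> x))"

definition tensor :: "real^'n \<Rightarrow> real^'n \<Rightarrow> real^'n^'n" where
  "tensor x y = matrix (\<lambda>z. (z \<bullet> y) *\<^sub>R x)"

definition SL :: "(real^'n^'n) set" where
  "SL = {T. det T = 1}"

text \<open>
  Log-concave functions are Lebesgue measurable but in general not Borel measurable, hence all
  integrals are taken with respect to \<open>lebesgue\<close> rather than \<open>lborel\<close>.
\<close>

definition overlap ::
  "(real^'n \<Rightarrow> real) \<Rightarrow> (real^'n \<Rightarrow> real) \<Rightarrow> real^'n^'n \<Rightarrow> real^'n \<Rightarrow> real" where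
  "overlap f g T z = (LINT x|lebesgue. f x * g (matrix_inv T *v (x - z)))"

text \<open>
  The supremum is taken in the extended reals, so that it is meaningful before it is known to be
  finite; since \<open>overlap\<close> is real valued, an attained supremum is finite.
\<close>

definition max_overlap :: "(real^'n \<Rightarrow> real) \<Rightarrow> (real^'n \<Rightarrow> real) \<Rightarrow> ereal" where
  "max_overlap f g = (SUP (T, z) \<in> SL \<times> UNIV. ereal (overlap f g T z))"

definition max_intersection_position :: "(real^'n \<Rightarrow> real) \<Rightarrow> (real^'n \<Rightarrow> real) \<Rightarrow> bool" where
  "max_intersection_position f g \<longleftrightarrow> ereal (overlap f g (mat 1) 0) = max_overlap f g"

definition C_const ::
  "(real^'n \<Rightarrow> real) \<Rightarrow> (real^'n \<Rightarrow> real) \<Rightarrow> (real^'n \<Rightarrow> ereal) \<Rightarrow> real" where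
  "C_const f g \<phi> =
     (1 / real CARD('n)) * (LINT x:supp f|lebesgue. (gradient_ereal \<phi> x \<bullet> x) * f x * g x)"

end

theory Submission
  imports Defs "HOL-Real_Asymp.Real_Asymp"
begin

text \<open>
  An affine substitution replaces the pair \<open>(T, z)\<close> by \<open>S = T\<inverse>\<close>, \<open>c = - S z\<close>, so that the overlap becomes
  \<open>G(S, c) = \<integral> f(x) g(S x + c) dx\<close> with \<open>det S = 1\<close>, and no inverse matrix is left in the integrand.

  Existence. A log-concave function that is integrable and positive on a set with interior points
  decays exponentially (\<open>log_concave_exp_decay\<close>). Hence \<open>G(S, c)\<close> is at most a constant times the
  integral of \<open>exp (- a (|x| + |S x + c|))\<close>. Replacing the \<open>j\<close>-th coordinate of \<open>x\<close> by the \<open>i\<close>-th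
  coordinate of \<open>S x + c\<close> is a substitution with Jacobian \<open>S\<^sub>i\<^sub>j\<close>, and the new point has norm at most
  \<open>|x| + |S x + c|\<close>; so \<open>G(S, c)\<close> is at most a constant divided by \<open>|S\<^sub>i\<^sub>j|\<close>, for each entry. For bounded \<open>S\<close>
  and large \<open>c\<close> the points \<open>x\<close> and \<open>S x + c\<close> cannot both be small, so \<open>G(S, c)\<close> is small there as well. As
  \<open>G\<close> is continuous, the positions with \<open>G(S, c) \<ge> G(I, 0)\<close> form a compact set if \<open>G(I, 0) > 0\<close>, and
  the maximum is attained on it (\<open>affine_overlap_maximizer\<close>). If \<open>G(I, 0) = 0\<close>, then \<open>f\<close> vanishes almost everywhere and
  every position is maximal.

  First-order conditions. Because \<open>g\<close> is supported everywhere, \<open>\<phi>\<close> is finite everywhere: a dense convex set is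
  the whole space. So \<open>g = exp (- p)\<close> with \<open>p\<close> convex, and \<open>p\<close> is differentiable almost everywhere
  (\<open>convex_gradient_AE\<close>). Let \<open>V\<close> be a vector field whose flow lines are the straight lines
  \<open>x + s V(x)\<close>, with \<open>V\<close> constant along each of them, and whose flow consists of affine maps of determinant one.
  Along this flow the overlap has its maximum at \<open>s = 0\<close>, so its derivative, the
  integral of \<open>f \<langle>\<nabla>g, V\<rangle>\<close>, vanishes. The derivative cannot be taken under the
  integral directly, since there is no evident integrable majorant for the difference quotients of \<open>g\<close>. For compactly
  supported \<open>f\<close> it can; the substitution \<open>y = x + s V(x)\<close> then moves the parameter from \<open>g\<close> to \<open>f\<close>,
  and in \<open>\<integral> f(y - s V(y)) \<langle>\<nabla>g(y), V(y)\<rangle> dy\<close> the exponential decay of \<open>f\<close> together with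
  \<open>\<nabla>g \<in> L\<^sup>2\<close> gives a majorant that depends neither on \<open>s\<close> nor on the support of \<open>f\<close>. With the mean
  value theorem the general case follows (\<open>first_variation_nonpos\<close>).

  The translations \<open>V = e\<^sub>i\<close> yield the vector identity. The fields \<open>V(x) = x\<^sub>j e\<^sub>i\<close> show that the matrix
  \<open>M = \<integral> f g \<nabla>\<phi> \<otimes> x\<close> has no entries off the diagonal, and \<open>V(x) = (x\<^sub>i - x\<^sub>j) (e\<^sub>i + e\<^sub>j)\<close> then shows that its
  diagonal is constant, hence equal to its trace divided by \<open>n\<close> (\<open>affine_stationarity\<close>).
\<close>


section \<open>Integration on Euclidean space\<close>

lemma LIMSEQ_one_over_Suc: "(\<lambda>k. 1 / (real k + 1)) \<longlonglongrightarrow> 0"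
  using LIMSEQ_inverse_real_of_nat by (simp add: inverse_eq_divide add.commute)

text \<open>
  On the shell \<open>k \<le> |x| \<le> k + 1\<close> the integrand is at most \<open>exp (- a k)\<close>, and the volume of the enclosing ball
  grows only polynomially in \<open>k\<close>.
\<close>

lemma nn_integral_exp_norm_finite:
  assumes a: "a > 0"
  shows "(\<integral>\<^sup>+ (x::'a::euclidean_space). ennreal (exp (- a * norm x)) \<partial>lborel) < \<infinity>"
proof -
  define v where "v = unit_ball_vol (real DIM('a))"
  have v0: "v \<ge> 0" unfolding v_def by (simp)
  have sm: "summable (\<lambda>k. exp (- a * real k) * (v * (real k + 1) ^ DIM('a)))"
  proof -
    have "summable (\<lambda>k. (exp (- a / 2)) ^ k)"
      by (rule summable_geometric) (use a in auto)
    moreover have "\<forall>\<^sub>F k in sequentially. norm (exp (- a * real k) * (v * (real k + 1) ^ DIM('a))) \<le> 1 * norm ((exp (- a / 2)) ^ k)"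
    proof -
      have "((\<lambda>k. exp (- (a/2) * real k) * (v * (real k + 1) ^ DIM('a))) \<longlongrightarrow> 0) sequentially"
        using a by real_asymp
      then have "\<forall>\<^sub>F k in sequentially. exp (- (a/2) * real k) * (v * (real k + 1) ^ DIM('a)) < 1"
        by (rule order_tendstoD) simp
      then show ?thesis
      proof eventually_elim
        case (elim k)
        have "exp (- a * real k) = exp (- (a/2) * real k) * exp (- a / 2) ^ k"
          by (simp add: exp_of_nat_mult [symmetric] mult_exp_exp)
        then have "exp (- a * real k) * (v * (real k + 1) ^ DIM('a))
            = (exp (- (a/2) * real k) * (v * (real k + 1) ^ DIM('a))) * exp (- a / 2) ^ k"
          by (simp add: mult_ac)
        also have "\<dots> \<le> 1 * exp (- a / 2) ^ k"
          using elim by (intro mult_right_mono) auto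
        finally show ?case using v0 by (simp add: abs_mult)
      qed
    qed
    ultimately show ?thesis
      by (intro summable_comparison_test_ev[OF _ \<open>summable ((^) (exp (- a / 2)))\<close>]) simp
  qed
  have "(\<integral>\<^sup>+ (x::'a). ennreal (exp (- a * norm x)) \<partial>lborel)
      \<le> (\<integral>\<^sup>+ (x::'a). (\<Sum>k. ennreal (exp (- a * real k)) * indicator (cball 0 (real k + 1)) x) \<partial>lborel)"
  proof (rule nn_integral_mono)
    fix x :: 'a
    define k where "k = nat \<lfloor>norm x\<rfloor>"
    have k: "real k \<le> norm x" "norm x \<le> real k + 1"
    proof -
      have "real k = of_int \<lfloor>norm x\<rfloor>" unfolding k_def by simp
      then show "real k \<le> norm x" "norm x \<le> real k + 1" by linarith+
    qed
    have "ennreal (exp (- a * norm x)) \<le> ennreal (exp (- a * real k)) * indicator (cball 0 (real k + 1)) x"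
      using k a by (auto intro!: ennreal_leI)
    also have "\<dots> \<le> (\<Sum>k. ennreal (exp (- a * real k)) * indicator (cball 0 (real k + 1)) x)"
    proof -
      define F :: "nat \<Rightarrow> ennreal" where "F = (\<lambda>k. ennreal (exp (- a * real k)) * indicator (cball 0 (real k + 1)) x)"
      have "F k = sum F {k}" by simp
      also have "\<dots> \<le> suminf F" by (rule sum_le_suminf) auto
      finally show ?thesis unfolding F_def .
    qed
    finally show "ennreal (exp (- a * norm x)) \<le> (\<Sum>k. ennreal (exp (- a * real k)) * indicator (cball 0 (real k + 1)) x)" .
  qed
  also have "\<dots> = (\<Sum>k. \<integral>\<^sup>+ (x::'a). ennreal (exp (- a * real k)) * indicator (cball 0 (real k + 1)) x \<partial>lborel)"
    by (intro nn_integral_suminf borel_measurable_times_ennreal borel_measurable_indicator) auto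
  also have "\<dots> = (\<Sum>k. ennreal (exp (- a * real k) * (v * (real k + 1) ^ DIM('a))))"
    by (simp add: nn_integral_cmult_indicator emeasure_cball v_def ennreal_mult')
  also have "\<dots> = ennreal (\<Sum>k. exp (- a * real k) * (v * (real k + 1) ^ DIM('a)))"
    by (rule suminf_ennreal2[OF _ sm]) (simp add: v0)
  also have "\<dots> < \<infinity>" by simp
  finally show ?thesis .
qed

lemma integrable_exp_norm:
  assumes a: "a > 0"
  shows "integrable lborel (\<lambda>x::'a::euclidean_space. exp (- a * norm x))"
  using nn_integral_exp_norm_finite[OF a]
  by (intro integrableI_nonneg) auto

text \<open>
  The map changes only the coordinate along \<open>j\<close>, which becomes the affine function \<open>w \<bullet> x + c\<close>. By Fubini it
  is enough to substitute in the one-dimensional integral over that coordinate, where the slope is \<open>w \<bullet> j\<close>.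
\<close>

lemma nn_integral_coordinate_substitution:
  fixes w j :: "'a::euclidean_space"
  assumes j: "j \<in> Basis" and wj: "w \<bullet> j \<noteq> 0" and F[measurable]: "F \<in> borel_measurable borel"
  shows "(\<integral>\<^sup>+ x. F (x + (w \<bullet> x - x \<bullet> j + c) *\<^sub>R j) \<partial>lborel) = (\<integral>\<^sup>+ x. F x \<partial>lborel) / ennreal \<bar>w \<bullet> j\<bar>"
proof -
  interpret product_sigma_finite "\<lambda>b::'a. lborel :: real measure"
    by unfold_locales
  define E :: "('a \<Rightarrow> real) \<Rightarrow> 'a" where "E = (\<lambda>f. \<Sum>b\<in>Basis. f b *\<^sub>R b)"
  define J where "J = Basis - {j}"
  have J: "finite J" "j \<notin> J" "Basis = insert j J" using j by (auto simp: J_def)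
  have E[measurable]: "E \<in> borel_measurable (Pi\<^sub>M (insert j J) (\<lambda>b. lborel))"
    unfolding E_def J(3)[symmetric] by measurable
  have lbE: "lborel = distr (Pi\<^sub>M Basis (\<lambda>b. lborel)) borel E"
    unfolding E_def by (rule lborel_eq)
  have lb: "(\<integral>\<^sup>+ x. H x \<partial>lborel) = (\<integral>\<^sup>+ f. (\<integral>\<^sup>+ y. H (E (f(j := y))) \<partial>lborel) \<partial>Pi\<^sub>M J (\<lambda>b. lborel))"
    if [measurable]: "H \<in> borel_measurable borel" for H :: "'a \<Rightarrow> ennreal"
  proof -
    have "(\<integral>\<^sup>+ x. H x \<partial>lborel) = (\<integral>\<^sup>+ f. H (E f) \<partial>Pi\<^sub>M Basis (\<lambda>b. lborel))"
      by (subst lbE, rule nn_integral_distr) (use E J(3) in simp_all)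
    also have "\<dots> = (\<integral>\<^sup>+ f. H (E f) \<partial>Pi\<^sub>M (insert j J) (\<lambda>b. lborel))"
      by (simp only: J(3))
    also have "\<dots> = (\<integral>\<^sup>+ f. (\<integral>\<^sup>+ y. H (E (f(j := y))) \<partial>lborel) \<partial>Pi\<^sub>M J (\<lambda>b. lborel))"
      by (intro product_nn_integral_insert J(1,2) measurable_compose[OF E that])
    finally show ?thesis .
  qed
  have Eupd: "E (f(j := y)) = E (f(j := 0)) + y *\<^sub>R j" for f y
  proof -
    have "E (f(j := y)) = y *\<^sub>R j + (\<Sum>b\<in>J. f b *\<^sub>R b)" for y
      unfolding E_def J(3) using J by (subst sum.insert) (auto intro!: sum.cong)
    from this[of y] this[of 0] show ?thesis by simp
  qed
  have Ej: "E (f(j := 0)) \<bullet> j = 0" for f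
  proof -
    have "E (f(j := 0)) \<bullet> j = (\<Sum>b\<in>Basis. (f(j := 0)) b * (b \<bullet> j))"
      unfolding E_def by (simp add: inner_sum_left)
    also have "\<dots> = 0"
      using j by (intro sum.neutral) (auto simp: inner_Basis)
    finally show ?thesis .
  qed
  have "(\<integral>\<^sup>+ x. F (x + (w \<bullet> x - x \<bullet> j + c) *\<^sub>R j) \<partial>lborel)
      = (\<integral>\<^sup>+ f. (\<integral>\<^sup>+ y. F (E (f(j := 0)) + ((w \<bullet> E (f(j := 0)) + c) + (w \<bullet> j) * y) *\<^sub>R j) \<partial>lborel) \<partial>Pi\<^sub>M J (\<lambda>b. lborel))"
  proof (subst lb)
    have "E (f(j := y)) + (w \<bullet> E (f(j := y)) - E (f(j := y)) \<bullet> j + c) *\<^sub>R j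
      = E (f(j := 0)) + ((w \<bullet> E (f(j := 0)) + c) + (w \<bullet> j) * y) *\<^sub>R j" for f y
      unfolding Eupd[of f y] using j by (simp add: inner_add_left inner_add_right Ej algebra_simps)
    then show "(\<integral>\<^sup>+ f. (\<integral>\<^sup>+ y. F (E (f(j := y)) + (w \<bullet> E (f(j := y)) - E (f(j := y)) \<bullet> j + c) *\<^sub>R j) \<partial>lborel) \<partial>Pi\<^sub>M J (\<lambda>b. lborel))
      = (\<integral>\<^sup>+ f. (\<integral>\<^sup>+ y. F (E (f(j := 0)) + ((w \<bullet> E (f(j := 0)) + c) + (w \<bullet> j) * y) *\<^sub>R j) \<partial>lborel) \<partial>Pi\<^sub>M J (\<lambda>b. lborel))"
      by simp
  qed measurable
  also have "\<dots> = (\<integral>\<^sup>+ f. (\<integral>\<^sup>+ y. F (E (f(j := y))) \<partial>lborel) / ennreal \<bar>w \<bullet> j\<bar> \<partial>Pi\<^sub>M J (\<lambda>b. lborel))"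
  proof (rule nn_integral_cong)
    fix f
    have "(\<integral>\<^sup>+ y. F (E (f(j := y))) \<partial>lborel) = (\<integral>\<^sup>+ y. F (E (f(j := 0)) + y *\<^sub>R j) \<partial>lborel)"
      by (intro nn_integral_cong arg_cong[where f = F] Eupd)
    also have "\<dots> = ennreal \<bar>w \<bullet> j\<bar> * (\<integral>\<^sup>+ y. F (E (f(j := 0)) + ((w \<bullet> E (f(j := 0)) + c) + (w \<bullet> j) * y) *\<^sub>R j) \<partial>lborel)"
      by (rule nn_integral_real_affine) (use wj in auto)
    finally show "(\<integral>\<^sup>+ y. F (E (f(j := 0)) + ((w \<bullet> E (f(j := 0)) + c) + (w \<bullet> j) * y) *\<^sub>R j) \<partial>lborel)
       = (\<integral>\<^sup>+ y. F (E (f(j := y))) \<partial>lborel) / ennreal \<bar>w \<bullet> j\<bar>"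
      using wj by (simp add: ennreal_mult_divide_eq mult.commute[of "ennreal \<bar>w \<bullet> j\<bar>"])
  qed
  also have "\<dots> = (\<integral>\<^sup>+ x. F x \<partial>lborel) / ennreal \<bar>w \<bullet> j\<bar>"
  proof -
    have "(\<lambda>f. \<integral>\<^sup>+ y. F (E (f(j := y))) \<partial>lborel) \<in> borel_measurable (Pi\<^sub>M J (\<lambda>b. lborel))"
      using E by measurable
    then show ?thesis unfolding lb[OF F] by (rule nn_integral_divide)
  qed
  finally show ?thesis .
qed

text \<open>
  The case of slope one: \<open>x \<bullet> j\<close> is replaced by itself plus an affine function of the other coordinates.
\<close>

lemma shear_preserves_lborel:
  fixes w j :: "'a::euclidean_space"
  assumes j: "j \<in> Basis" and wj: "w \<bullet> j = 0"
  shows "distr lborel borel (\<lambda>x. x + (w \<bullet> x + c) *\<^sub>R j) = lborel"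
proof (rule measure_eqI)
  fix A assume A: "A \<in> sets (distr lborel borel (\<lambda>x. x + (w \<bullet> x + c) *\<^sub>R j))"
  then have [measurable]: "A \<in> sets borel" by simp
  have eq: "x + (w \<bullet> x + c) *\<^sub>R j = x + ((w + j) \<bullet> x - x \<bullet> j + c) *\<^sub>R j" for x
    by (simp add: inner_add_left inner_commute[of x j])
  have "emeasure (distr lborel borel (\<lambda>x. x + (w \<bullet> x + c) *\<^sub>R j)) A
      = (\<integral>\<^sup>+ x. indicator A x \<partial>distr lborel borel (\<lambda>x. x + (w \<bullet> x + c) *\<^sub>R j))"
    by simp
  also have "\<dots> = (\<integral>\<^sup>+ x. indicator A (x + ((w + j) \<bullet> x - x \<bullet> j + c) *\<^sub>R j) \<partial>lborel)"
    by (subst nn_integral_distr) (auto simp: eq)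
  also have "\<dots> = emeasure lborel A"
    using j wj by (subst nn_integral_coordinate_substitution) (auto simp: inner_add_left divide_ennreal_def)
  finally show "emeasure (distr lborel borel (\<lambda>x. x + (w \<bullet> x + c) *\<^sub>R j)) A = emeasure lborel A" .
qed simp

text \<open>
  The functions in the theorem are only Lebesgue measurable. This passes to a Borel version, for which
  measurability under substitutions is automatic.
\<close>

lemma lebesgue_integral_via_borel:
  fixes F F' :: "'a::euclidean_space \<Rightarrow> 'b::euclidean_space"
  assumes F'[measurable]: "F' \<in> borel_measurable borel" and eq: "AE x in lebesgue. F x = F' x"
  shows "integrable lebesgue F \<longleftrightarrow> integrable lborel F'"
    and "integral\<^sup>L lebesgue F = integral\<^sup>L lborel F'"
proof -
  have F'l: "F' \<in> borel_measurable lebesgue" using F' by (intro measurable_completion) simp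
  have Fl: "F \<in> borel_measurable lebesgue"
    by (rule borel_measurable_AE[OF F'l]) (use eq in eventually_elim, simp)
  have "integrable lebesgue F \<longleftrightarrow> integrable lebesgue F'"
    by (rule integrable_cong_AE[OF Fl F'l eq])
  then show "integrable lebesgue F \<longleftrightarrow> integrable lborel F'"
    by (simp add: integrable_completion)
  have "integral\<^sup>L lebesgue F = integral\<^sup>L lebesgue F'"
    by (rule integral_cong_AE[OF Fl F'l eq])
  then show "integral\<^sup>L lebesgue F = integral\<^sup>L lborel F'"
    by (simp add: integral_completion)
qed

section \<open>Matrices of determinant one\<close>

text \<open>
  The elementary matrix \<open>I + t E\<^sub>i\<^sub>j\<close>, written by rows so that it is visibly the result of a row operation.
\<close>

definition transvection :: "'n \<Rightarrow> 'n \<Rightarrow> real \<Rightarrow> real^'n^'n" where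
  "transvection i j t = (\<chi> k. if k = i then row i (mat 1) + t *s row j (mat 1) else row k (mat 1))"

lemma det_transvection: "i \<noteq> j \<Longrightarrow> det (transvection i j t) = 1"
  unfolding transvection_def by (simp add: det_row_operation)

lemma transvection_mult:
  fixes x :: "real^'n"
  shows "transvection i j t *v x = x + (t * x $ j) *\<^sub>R axis i 1"
proof -
  have r: "row k (mat 1) \<bullet> x = x $ k" for k :: 'n
  proof -
    have "row k (mat 1 :: real^'n^'n) = axis k 1" by (simp add: row_def mat_def axis_def vec_eq_iff eq_commute)
    then show ?thesis by (simp add: inner_axis')
  qed
  have "(transvection i j t *v x) $ k = (x + (t * x $ j) *\<^sub>R axis i 1) $ k" for k
    by (simp add: matrix_mult_dot transvection_def r inner_add_left scalar_mult_eq_scaleR axis_def)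
  then show ?thesis by (simp add: vec_eq_iff)
qed

lemma distr_transvection:
  assumes "i \<noteq> j"
  shows "distr lborel borel (\<lambda>x. transvection i j t *v x) = lborel"
proof -
  have "distr lborel borel (\<lambda>x. x + ((t *\<^sub>R axis j 1) \<bullet> x + 0) *\<^sub>R axis i (1::real)) = lborel"
    by (rule shear_preserves_lborel) (use assms in \<open>auto simp: inner_axis_axis\<close>)
  then show ?thesis by (simp add: transvection_mult inner_axis')
qed

lemma matrix_inv_det_1:
  fixes T :: "real^'n^'n"
  assumes "det T = 1"
  shows "T ** matrix_inv T = mat 1" "matrix_inv T ** T = mat 1" "det (matrix_inv T) = 1"
    "matrix_inv (matrix_inv T) = T"
proof -
  have "invertible T" using assms by (simp add: invertible_det_nz)
  then have "T ** matrix_inv T = mat 1 \<and> matrix_inv T ** T = mat 1"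
    unfolding matrix_inv_def invertible_def by (rule someI_ex)
  then show 1: "T ** matrix_inv T = mat 1" and "matrix_inv T ** T = mat 1" by auto
  have "det T * det (matrix_inv T) = 1" using 1 by (metis det_mul det_I)
  then show d: "det (matrix_inv T) = 1" using assms by simp
  have "invertible (matrix_inv T)" using d by (simp add: invertible_det_nz)
  then have "matrix_inv T ** matrix_inv (matrix_inv T) = mat 1 \<and> matrix_inv (matrix_inv T) ** matrix_inv T = mat 1"
    unfolding matrix_inv_def[of "matrix_inv T"] invertible_def by (rule someI_ex)
  then show "matrix_inv (matrix_inv T) = T"
    using 1 matrix_mul_assoc[of T "matrix_inv T" "matrix_inv (matrix_inv T)"] by simp
qed

section \<open>Log-concave functions\<close>

lemma exp_neg_nonneg: "exp_neg t \<ge> 0"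
  by (simp add: exp_neg_def)

lemma log_concave_nonneg: "log_concave h \<Longrightarrow> h x \<ge> 0"
  by (auto simp: log_concave_def exp_neg_nonneg)

text \<open>
  Log-concavity in multiplicative form. The convention \<open>0 powr 0 = 0\<close> makes the left side vanish as soon as
  one of the two values does.
\<close>

lemma log_concave_powr:
  assumes h: "log_concave h" and uv: "0 \<le> u" "0 \<le> v" "u + v = 1"
  shows "h x powr u * h y powr v \<le> h (u *\<^sub>R x + v *\<^sub>R y)"
proof (cases "h x = 0 \<or> h y = 0")
  case True
  then show ?thesis using log_concave_nonneg[OF h, of "u *\<^sub>R x + v *\<^sub>R y"] by auto
next
  case False
  obtain \<phi> where c: "convex_ereal \<phi>" and h: "h = (\<lambda>x. exp_neg (\<phi> x))"
    using h by (auto simp: log_concave_def)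
  have fin: "\<bar>\<phi> x\<bar> \<noteq> \<infinity>" "\<bar>\<phi> y\<bar> \<noteq> \<infinity>"
    using False c by (auto simp: h exp_neg_def convex_ereal_def split: if_splits)
  then obtain a b where a: "\<phi> x = ereal a" and b: "\<phi> y = ereal b" by auto
  have le: "\<phi> (u *\<^sub>R x + v *\<^sub>R y) \<le> ereal (u * a + v * b)"
  proof -
    have "\<phi> (u *\<^sub>R x + v *\<^sub>R y) \<le> ereal u * \<phi> x + ereal v * \<phi> y"
      using c uv unfolding convex_ereal_def by blast
    then show ?thesis by (simp add: a b)
  qed
  moreover have "\<phi> (u *\<^sub>R x + v *\<^sub>R y) \<noteq> -\<infinity>" using c by (auto simp: convex_ereal_def)
  ultimately obtain d where d: "\<phi> (u *\<^sub>R x + v *\<^sub>R y) = ereal d"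
    by (cases "\<phi> (u *\<^sub>R x + v *\<^sub>R y)") auto
  have "h x powr u * h y powr v = exp (- (u * a + v * b))"
    by (simp add: h exp_neg_def a b powr_def mult_exp_exp)
  also have "\<dots> \<le> exp (- d)" using le d by simp
  finally show ?thesis by (simp add: h exp_neg_def d)
qed

lemma convex_superlevel_log_concave:
  assumes h: "log_concave h" and t: "t > 0"
  shows "convex {x. t \<le> h x}"
proof (rule convexI)
  fix x y and u v :: real
  assume xy: "x \<in> {x. t \<le> h x}" "y \<in> {x. t \<le> h x}" and uv: "0 \<le> u" "0 \<le> v" "u + v = 1"
  have "t = t powr u * t powr v" using t uv by (simp add: powr_add [symmetric])
  also have "\<dots> \<le> h x powr u * h y powr v"
    using xy t uv by (intro mult_mono powr_mono2) auto
  also have "\<dots> \<le> h (u *\<^sub>R x + v *\<^sub>R y)" by (rule log_concave_powr) (use h uv in auto)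
  finally show "u *\<^sub>R x + v *\<^sub>R y \<in> {x. t \<le> h x}" by simp
qed

lemma convex_nonzero_log_concave:
  assumes h: "log_concave h"
  shows "convex {x. h x \<noteq> 0}"
proof (rule convexI)
  fix x y and u v :: real
  assume xy: "x \<in> {x. h x \<noteq> 0}" "y \<in> {x. h x \<noteq> 0}" and uv: "0 \<le> u" "0 \<le> v" "u + v = 1"
  have "0 < h x powr u * h y powr v" using xy by simp
  also have "\<dots> \<le> h (u *\<^sub>R x + v *\<^sub>R y)" by (rule log_concave_powr) (use h uv in auto)
  finally show "u *\<^sub>R x + v *\<^sub>R y \<in> {x. h x \<noteq> 0}" by simp
qed

text \<open>
  A convex set containing a ball of radius \<open>r\<close> and a point \<open>y\<close> contains the shrunken balls along the segment
  to \<open>y\<close>. On the first half of the segment their radii are at least \<open>r / 2\<close>, so a distant \<open>y\<close> gives room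
  for many disjoint balls of one fixed size.
\<close>

lemma convex_finite_measure_bounded:
  fixes L :: "'a::euclidean_space set"
  assumes L: "convex L" and fm: "L \<in> lmeasurable" and r: "r > 0" and ball: "ball x0 r \<subseteq> L"
  shows "\<exists>R. \<forall>y\<in>L. dist x0 y \<le> R"
proof -
  define m where "m = measure lebesgue (ball (0::'a) (r/2))"
  have m: "m > 0" unfolding m_def using r by (simp add: content_ball_pos)
  have "dist x0 y \<le> 2 * r * (measure lebesgue L / m + 1)" if y: "y \<in> L" for y
  proof (rule ccontr)
    assume "\<not> ?thesis"
    then have far: "2 * r * (measure lebesgue L / m + 1) < dist x0 y" by simp
    \<comment> \<open>one ball more than the measure of \<open>L\<close> can accommodate\<close>
    define N where "N = nat \<lfloor>measure lebesgue L / m\<rfloor> + 1"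
    have N: "measure lebesgue L / m < real N" "real N \<le> measure lebesgue L / m + 1"
      unfolding N_def using m by (auto simp: of_nat_nat) linarith+
    have d: "2 * r * real N \<le> dist x0 y"
      using far N(2) mult_left_mono[OF N(2), of "2 * r"] r by linarith
    have pos: "dist x0 y > 0"
    proof -
      have "0 < 2 * r * (measure lebesgue L / m + 1)"
        using m r by (intro mult_pos_pos) (auto intro!: add_nonneg_pos divide_nonneg_pos)
      then show ?thesis using far by linarith
    qed
    define e where "e = (1 / dist x0 y) *\<^sub>R (y - x0)"
    have ne: "norm e = 1" using pos unfolding e_def by (simp add: dist_norm norm_minus_commute)
    define B where "B k = ball (x0 + (real k * r) *\<^sub>R e) (r / 2)" for k :: nat
    have sub: "B k \<subseteq> L" if "k < N" for k
    proof
      fix z assume z: "z \<in> B k"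
      define s where "s = real k * r / dist x0 y"
      have s: "0 \<le> s" "s \<le> 1/2"
      proof -
        show "0 \<le> s" unfolding s_def using r by simp
        have "real k * r \<le> real N * r" using that r by simp
        then show "s \<le> 1/2" unfolding s_def using d pos by (simp add: field_simps)
      qed
      have cen: "x0 + (real k * r) *\<^sub>R e = (1 - s) *\<^sub>R x0 + s *\<^sub>R y"
        unfolding e_def s_def by (simp add: algebra_simps)
      \<comment> \<open>\<open>q\<close> is the point of the large ball from which the homothety with centre \<open>y\<close> and ratio \<open>1 - s\<close> reaches \<open>z\<close>\<close>
      define q where "q = x0 + (1 / (1 - s)) *\<^sub>R (z - ((1 - s) *\<^sub>R x0 + s *\<^sub>R y))"
      have "norm (z - ((1 - s) *\<^sub>R x0 + s *\<^sub>R y)) < r / 2"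
        using z unfolding B_def cen by (simp add: dist_norm norm_minus_commute)
      then have "dist x0 q < r"
      proof -
        assume n: "norm (z - ((1 - s) *\<^sub>R x0 + s *\<^sub>R y)) < r / 2"
        have "dist x0 q = norm (z - ((1 - s) *\<^sub>R x0 + s *\<^sub>R y)) / (1 - s)"
          unfolding q_def dist_norm using s by simp
        also have "\<dots> \<le> norm (z - ((1 - s) *\<^sub>R x0 + s *\<^sub>R y)) / (1/2)"
          using s by (intro divide_left_mono) auto
        also have "\<dots> < r" using n by simp
        finally show ?thesis .
      qed
      then have "q \<in> L" using ball by auto
      moreover have "z = (1 - s) *\<^sub>R q + s *\<^sub>R y"
      proof -
        have "(1 - s) *\<^sub>R q = (1 - s) *\<^sub>R x0 + (z - ((1 - s) *\<^sub>R x0 + s *\<^sub>R y))"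
          unfolding q_def using s by (simp add: scaleR_add_right)
        then show ?thesis by simp
      qed
      ultimately show "z \<in> L"
        using convexD[OF L \<open>q \<in> L\<close> y, of "1 - s" s] s by auto
    qed
    have disj: "disjoint_family_on B {..<N}"
    proof (unfold disjoint_family_on_def, intro ballI impI)
      fix i k :: nat assume ik: "i \<noteq> k"
      have "dist (x0 + (real i * r) *\<^sub>R e) (x0 + (real k * r) *\<^sub>R e) = \<bar>real i - real k\<bar> * r"
        using r ne by (simp add: dist_norm scaleR_diff_left [symmetric] left_diff_distrib [symmetric] abs_mult)
      also have "\<dots> \<ge> 1 * r" using ik r by (intro mult_right_mono) auto
      finally show "B i \<inter> B k = {}"
        unfolding B_def by (intro disjoint_ballI) simp
    qed
    have Bm: "measure lebesgue (B k) = m" for k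
      unfolding B_def m_def
      using measure_translation[of "x0 + (real k * r) *\<^sub>R e" "ball 0 (r/2)"] by (simp)
    have Bsets: "B k \<in> sets lebesgue" for k unfolding B_def by simp
    have Bfin: "emeasure lebesgue (B k) \<noteq> \<infinity>" for k
      using emeasure_lborel_ball_finite[of "x0 + (real k * r) *\<^sub>R e" "r/2"] unfolding B_def by simp
    have "real N * m = (\<Sum>k<N. measure lebesgue (B k))" by (simp add: Bm)
    also have "\<dots> = measure lebesgue (\<Union>k<N. B k)"
      by (rule measure_finite_Union[symmetric])
         (use disj Bfin Bsets in auto)
    also have "\<dots> \<le> measure lebesgue L"
      by (rule measure_mono_fmeasurable) (use sub fm in \<open>auto simp: B_def\<close>)
    finally have "real N \<le> measure lebesgue L / m" using m by (simp add: field_simps)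
    then show False using N(1) by linarith
  qed
  then show ?thesis by blast
qed

text \<open>
  Some superlevel set of \<open>h\<close> at a height \<open>\<delta>\<close> contains a ball around a point \<open>x0\<close>. The superlevel set at height
  \<open>\<delta> / e\<close> has finite measure, hence lies in a ball of radius \<open>\<rho>\<close>. Outside of it, concavity of \<open>ln h\<close> along rays
  from \<open>x0\<close> continues the drop by one per length \<open>\<rho>\<close>. Inside, a large value at \<open>x\<close> is excluded by reflecting
  \<open>x\<close> through \<open>x0\<close> into the small ball, where \<open>h \<ge> \<delta>\<close>: the value at \<open>x0\<close>, which lies between, would be too large.
\<close>

lemma log_concave_exp_decay:
  fixes h :: "'a::euclidean_space \<Rightarrow> real"
  assumes h: "log_concave h" and int: "integrable lebesgue h" and ne: "interior {x. h x \<noteq> 0} \<noteq> {}"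
  shows "\<exists>A a. A > 0 \<and> a > 0 \<and> (\<forall>x. h x \<le> A * exp (- a * norm x))"
proof -
  have h0: "h x \<ge> 0" for x by (rule log_concave_nonneg[OF h])
  have "\<not> negligible {x. h x \<noteq> 0}"
    using negligible_convex_interior[OF convex_nonzero_log_concave[OF h]] ne by simp
  moreover have "{x. h x \<noteq> 0} = (\<Union>k::nat. {x. 1 / (real k + 1) \<le> h x})"
  proof (intro equalityI subsetI)
    fix x assume "x \<in> {x. h x \<noteq> 0}"
    then have "h x > 0" using h0[of x] by simp
    then obtain k where "inverse (real (Suc k)) < h x" using reals_Archimedean by blast
    then show "x \<in> (\<Union>k::nat. {x. 1 / (real k + 1) \<le> h x})"
      by (auto simp: field_simps intro!: exI[of _ k])
  qed (auto simp: field_simps)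
  ultimately obtain k :: nat where k: "\<not> negligible {x. 1 / (real k + 1) \<le> h x}"
    using negligible_countable_Union[of "range (\<lambda>k::nat. {x. 1 / (real k + 1) \<le> h x})"] by auto
  define \<delta> where "\<delta> = 1 / (real k + 1)"
  have \<delta>: "\<delta> > 0" unfolding \<delta>_def by simp
  have "interior {x. \<delta> \<le> h x} \<noteq> {}"
    using k negligible_convex_interior[OF convex_superlevel_log_concave[OF h \<delta>]] by (simp add: \<delta>_def)
  then obtain x0 r where r: "r > 0" "cball x0 r \<subseteq> {x. \<delta> \<le> h x}"
    using mem_interior_cball by (metis ex_in_conv)
  have hx0: "h x0 \<ge> \<delta>" using r by (auto simp: subset_iff)
  define t where "t = \<delta> * exp (-1)"
  have t: "t > 0" "t \<le> \<delta>" unfolding t_def using \<delta> by auto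
  have hm: "h \<in> borel_measurable lebesgue" using int by auto
  have lm: "{x. t \<le> h x} \<in> lmeasurable"
  proof (rule fmeasurableI)
    show s: "{x. t \<le> h x} \<in> sets lebesgue"
      using borel_measurable_le[of "\<lambda>_. t" lebesgue h] hm by simp
    have "emeasure lebesgue {x \<in> space lebesgue. ennreal (norm (h x)) \<ge> ennreal t} < \<infinity>"
    proof -
      have "ennreal t * emeasure lebesgue {x. t \<le> h x} = (\<integral>\<^sup>+x. ennreal t * indicator {x. t \<le> h x} x \<partial>lebesgue)"
        using s by (subst nn_integral_cmult_indicator) auto
      also have "\<dots> \<le> (\<integral>\<^sup>+x. ennreal (norm (h x)) \<partial>lebesgue)"
        using h0 t by (intro nn_integral_mono) (auto simp: indicator_def)
      also have "\<dots> < \<infinity>" using int by (simp add: integrable_iff_bounded)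
      finally show ?thesis using t h0
        by (auto simp: ennreal_mult_eq_top_iff less_top[symmetric])
    qed
    then show "emeasure lebesgue {x. t \<le> h x} < \<infinity>" using h0 t by simp
  qed
  have "ball x0 r \<subseteq> {x. t \<le> h x}"
  proof
    fix z assume "z \<in> ball x0 r"
    then have "z \<in> cball x0 r" by simp
    then have "\<delta> \<le> h z" using r(2) by blast
    then show "z \<in> {x. t \<le> h x}" using t(2) by simp
  qed
  then obtain R where R: "\<And>y. h y \<ge> t \<Longrightarrow> dist x0 y \<le> R"
    using convex_finite_measure_bounded[OF convex_superlevel_log_concave[OF h t(1)] lm r(1), of x0] by (auto simp: subset_iff)
  define \<rho> where "\<rho> = \<bar>R\<bar> + 1"
  have \<rho>: "\<rho> > 0" "\<And>y. dist x0 y \<ge> \<rho> \<Longrightarrow> h y < t"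
    unfolding \<rho>_def using R by (auto simp: not_le[symmetric]) (smt (verit) R)
  have far: "h x \<le> \<delta> * exp (- dist x0 x / \<rho>)" if x: "dist x0 x \<ge> \<rho>" for x
  proof (cases "h x = 0")
    case True then show ?thesis using \<delta> by simp
  next
    case False
    then have hx: "h x > 0" using h0[of x] by simp
    define l where "l = \<rho> / dist x0 x"
    have l: "0 < l" "l \<le> 1" 
    proof -
      have "dist x0 x > 0" using x \<rho>(1) by linarith
      then show "0 < l" "l \<le> 1" unfolding l_def using x \<rho>(1) by (simp_all add: divide_le_eq_1)
    qed
    define y where "y = (1 - l) *\<^sub>R x0 + l *\<^sub>R x"
    have "dist x0 y = l * dist x0 x"
    proof -
      have "x0 - y = l *\<^sub>R (x0 - x)" unfolding y_def by (simp add: algebra_simps)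
      then show ?thesis using l by (simp add: dist_norm)
    qed
    also have "\<dots> = \<rho>" unfolding l_def using x \<rho>(1) by auto
    finally have "h y < t" using \<rho>(2) by simp
    moreover have "h x0 powr (1 - l) * h x powr l \<le> h y"
      unfolding y_def by (rule log_concave_powr) (use h l in auto)
    moreover have "\<delta> powr (1 - l) * h x powr l \<le> h x0 powr (1 - l) * h x powr l"
      using hx0 \<delta> l by (intro mult_right_mono powr_mono2) auto
    ultimately have "\<delta> powr (1 - l) * h x powr l < \<delta> * exp (-1)" unfolding t_def by linarith
    then have "ln (\<delta> powr (1 - l) * h x powr l) < ln (\<delta> * exp (-1))"
      using \<delta> hx by (subst ln_less_cancel_iff) auto
    then have "(1 - l) * ln \<delta> + l * ln (h x) < ln \<delta> - 1"
      using \<delta> hx by (simp add: ln_mult ln_powr)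
    then have "l * (ln (h x) - ln \<delta>) < -1" by (simp add: algebra_simps)
    then have "ln (h x) - ln \<delta> < - 1 / l" using l by (simp add: field_simps)
    also have "- 1 / l = - dist x0 x / \<rho>" unfolding l_def by simp
    finally have "ln (h x) \<le> ln \<delta> + - dist x0 x / \<rho>" by simp
    then have "exp (ln (h x)) \<le> exp (ln \<delta> + - dist x0 x / \<rho>)" by (simp only: exp_le_cancel_iff)
    then show ?thesis unfolding exp_add using hx \<delta> by simp
  qed
  \<comment> \<open>\<open>x0\<close> divides the segment from the reflected point \<open>z\<close> to \<open>x\<close> in the ratio \<open>q : 1 - q\<close>\<close>
  define q where "q = r / (\<rho> + r)"
  have q: "0 < q" "q < 1" unfolding q_def using r \<rho>(1) by (auto simp: field_simps)
  define B where "B = exp ((ln (h x0) - (1 - q) * ln \<delta>) / q)"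
  have near: "h x \<le> B" if x: "dist x0 x \<le> \<rho>" for x
  proof (cases "h x = 0")
    case True then show ?thesis unfolding B_def by simp
  next
    case False
    then have hx: "h x > 0" using h0[of x] by simp
    define z where "z = x0 - (r / \<rho>) *\<^sub>R (x - x0)"
    have "dist x0 z = r / \<rho> * dist x0 x"
      unfolding z_def using r \<rho>(1) by (simp add: dist_norm norm_minus_commute)
    also have "\<dots> \<le> r / \<rho> * \<rho>" using x r \<rho>(1) by (intro mult_left_mono) auto
    finally have "dist x0 z \<le> r" using \<rho>(1) by simp
    then have hz: "h z \<ge> \<delta>" using r by auto
    have "(1 - q) *\<^sub>R z + q *\<^sub>R x = x0 + (q - (1 - q) * (r / \<rho>)) *\<^sub>R (x - x0)"
      unfolding z_def by (simp add: algebra_simps)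
    also have "q - (1 - q) * (r / \<rho>) = 0"
      unfolding q_def using r \<rho>(1) by (simp add: divide_simps)
    finally have e: "(1 - q) *\<^sub>R z + q *\<^sub>R x = x0" by simp
    have "\<delta> powr (1 - q) * h x powr q \<le> h z powr (1 - q) * h x powr q"
      using hz \<delta> q by (intro mult_right_mono powr_mono2) auto
    also have "\<dots> \<le> h ((1 - q) *\<^sub>R z + q *\<^sub>R x)"
      by (rule log_concave_powr) (use h q in auto)
    finally have "\<delta> powr (1 - q) * h x powr q \<le> h x0" unfolding e .
    then have "ln (\<delta> powr (1 - q) * h x powr q) \<le> ln (h x0)"
      using \<delta> hx hx0 by (subst ln_le_cancel_iff) auto
    then have "(1 - q) * ln \<delta> + q * ln (h x) \<le> ln (h x0)"
      using \<delta> hx by (simp add: ln_mult ln_powr)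
    then have "ln (h x) \<le> (ln (h x0) - (1 - q) * ln \<delta>) / q" using q by (simp add: field_simps)
    then have "exp (ln (h x)) \<le> B" unfolding B_def by (simp only: exp_le_cancel_iff)
    then show ?thesis using hx by simp
  qed
  define A where "A = (B + \<delta>) * exp 1 * exp (norm x0 / \<rho>)"
  have "h x \<le> A * exp (- (1 / \<rho>) * norm x)" for x
  proof -
    have B0: "B > 0" unfolding B_def by simp
    have "h x \<le> (B + \<delta>) * exp 1 * exp (- dist x0 x / \<rho>)"
    proof (cases "dist x0 x \<ge> \<rho>")
      case True
      have "\<delta> * exp (- dist x0 x / \<rho>) \<le> ((B + \<delta>) * exp 1) * exp (- dist x0 x / \<rho>)"
        using B0 \<delta> by (intro mult_right_mono order_trans[OF _ mult_mono[of \<delta> "B + \<delta>" 1 "exp 1"]]) auto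
      then show ?thesis using far[OF True] by linarith
    next
      case False
      have "h x \<le> (B + \<delta>) * 1" using near[of x] False \<delta> by simp
      also have "\<dots> \<le> (B + \<delta>) * exp (1 + - dist x0 x / \<rho>)"
        using False \<rho>(1) B0 \<delta> by (intro mult_left_mono) (auto simp: field_simps)
      finally show ?thesis by (simp only: exp_add mult.assoc)
    qed
    also have "\<dots> \<le> (B + \<delta>) * exp 1 * exp (norm x0 / \<rho> + - (1 / \<rho>) * norm x)"
    proof -
      have "norm x \<le> norm x0 + dist x0 x"
        unfolding dist_norm using norm_triangle_sub[of x x0] by (simp add: norm_minus_commute)
      then have "- dist x0 x / \<rho> \<le> norm x0 / \<rho> + - (1 / \<rho>) * norm x"
        using \<rho>(1) by (simp add: field_simps)
      then show ?thesis using B0 \<delta> by (intro mult_left_mono) auto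
    qed
    finally show ?thesis unfolding A_def by (simp only: exp_add mult.assoc)
  qed
  moreover have "A > 0" unfolding A_def B_def using \<delta> by (simp add: add_pos_pos)
  moreover have "1 / \<rho> > 0" using \<rho>(1) by simp
  ultimately show ?thesis by blast
qed

text \<open>
  A convex set and its closure have the same interior, so a dense convex domain is everything.
\<close>

lemma log_concave_full_support:
  fixes \<phi> :: "'a::euclidean_space \<Rightarrow> ereal"
  assumes \<phi>: "convex_ereal \<phi>" and full: "supp (\<lambda>x. exp_neg (\<phi> x)) = UNIV"
  shows "\<phi> x = ereal (real_of_ereal (\<phi> x))"
    and "convex_on UNIV (\<lambda>x. real_of_ereal (\<phi> x))"
proof -
  have "log_concave (\<lambda>x. exp_neg (\<phi> x))" using \<phi> by (auto simp: log_concave_def)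
  from convex_interior_closure[OF convex_nonzero_log_concave[OF this]]
  have "interior {x. exp_neg (\<phi> x) \<noteq> 0} = UNIV" using full by (simp add: supp_def)
  then have "exp_neg (\<phi> x) \<noteq> 0" for x using interior_subset by blast
  then have top: "\<phi> x \<noteq> \<infinity>" for x by (metis exp_neg_def)
  have *: "\<bar>\<phi> x\<bar> \<noteq> \<infinity>" for x
  proof -
    have "\<phi> x \<noteq> -\<infinity>" using \<phi> unfolding convex_ereal_def by blast
    then show ?thesis using top[of x] by auto
  qed
  then have fin: "\<phi> x = ereal (real_of_ereal (\<phi> x))" for x by (simp add: ereal_real')
  then show "\<phi> x = ereal (real_of_ereal (\<phi> x))" .
  show "convex_on UNIV (\<lambda>x. real_of_ereal (\<phi> x))"
    unfolding convex_on_def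
  proof (intro conjI ballI allI impI)
    fix x y and u v :: real assume "0 \<le> u" "0 \<le> v" "u + v = 1"
    then have "\<phi> (u *\<^sub>R x + v *\<^sub>R y) \<le> ereal u * \<phi> x + ereal v * \<phi> y"
      using \<phi> unfolding convex_ereal_def by blast
    also have "\<dots> = ereal (u * real_of_ereal (\<phi> x) + v * real_of_ereal (\<phi> y))"
      by (subst (1 2) fin) simp
    finally show "real_of_ereal (\<phi> (u *\<^sub>R x + v *\<^sub>R y)) \<le> u * real_of_ereal (\<phi> x) + v * real_of_ereal (\<phi> y)"
      by (subst (asm) fin) simp
  qed simp
qed

text \<open>
  A log-concave function is continuous in the interior of the convex set where it is positive, and the boundary of
  a convex set is a null set. Cutting \<open>f\<close> off outside that interior thus gives a Borel function which is continuous
  almost everywhere. If the interior is empty, the result is \<open>0\<close>; this is why the cut-off function, unlike \<open>f\<close>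
  itself, always decays.
\<close>

lemma log_concave_regular_version:
  fixes f :: "'a::euclidean_space \<Rightarrow> real"
  assumes f: "log_concave f" and int: "integrable lebesgue f"
  obtains f' A a where "f' \<in> borel_measurable borel" "\<And>x. 0 \<le> f' x" "AE x in lebesgue. f x = f' x"
    "AE x in lborel. isCont f' x" "A > 0" "a > 0" "\<And>x. f' x \<le> A * exp (- a * norm x)"
proof -
  define K where "K = {x. f x \<noteq> 0}"
  define U where "U = interior K"
  define f' where "f' x = indicator U x *\<^sub>R f x" for x
  have Kc: "convex K" unfolding K_def by (rule convex_nonzero_log_concave[OF f])
  have f0: "0 \<le> f x" for x by (rule log_concave_nonneg[OF f])
  have pos: "f x > 0" if "x \<in> U" for x
    using that interior_subset[of K] f0[of x] by (auto simp: U_def K_def less_le)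
  have oU: "open U" unfolding U_def by simp
  have cU: "convex U" unfolding U_def by (rule convex_interior[OF Kc])
  have "convex_on U (\<lambda>x. - ln (f x))"
    unfolding convex_on_def
  proof (intro conjI cU ballI allI impI)
    fix x y and u v :: real assume xy: "x \<in> U" "y \<in> U" and uv: "0 \<le> u" "0 \<le> v" "u + v = 1"
    have z: "u *\<^sub>R x + v *\<^sub>R y \<in> U" using convexD[OF cU xy uv] .
    have "f x powr u * f y powr v \<le> f (u *\<^sub>R x + v *\<^sub>R y)" by (rule log_concave_powr[OF f uv])
    then have "ln (f x powr u * f y powr v) \<le> ln (f (u *\<^sub>R x + v *\<^sub>R y))"
      using pos xy z by (subst ln_le_cancel_iff) (auto simp: less_imp_neq[symmetric])
    then show "- ln (f (u *\<^sub>R x + v *\<^sub>R y)) \<le> u * - ln (f x) + v * - ln (f y)"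
      using pos[OF xy(1)] pos[OF xy(2)] by (simp add: ln_mult ln_powr)
  qed
  then have "continuous_on U (\<lambda>x. exp (- (- ln (f x))))"
    by (intro continuous_on_exp continuous_on_minus convex_on_continuous[OF oU])
  then have cont: "continuous_on U f" by (rule continuous_on_eq) (simp add: pos)
  have "f' \<in> borel_measurable borel"
    unfolding f'_def using oU cont by (intro borel_measurable_continuous_on_indicator) auto
  moreover have "0 \<le> f' x" for x unfolding f'_def using f0 by simp
  moreover have fr: "AE x in lborel. x \<notin> frontier K"
    using negligible_convex_frontier[OF Kc] unfolding negligible_iff_null_sets
    by (subst AE_completion_iff[symmetric]) (rule AE_not_in)
  have eq: "f x = f' x" if "x \<notin> frontier K" for x
  proof (cases "x \<in> U")
    case False
    then have "x \<notin> K" using that closure_subset[of K] unfolding U_def frontier_def by auto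
    then show ?thesis using False unfolding f'_def K_def by simp
  qed (simp add: f'_def)
  have "AE x in lebesgue. f x = f' x"
    using AE_completion[OF fr] by eventually_elim (rule eq)
  moreover have "AE x in lborel. isCont f' x"
    using fr
  proof eventually_elim
    case (elim x)
    then consider "x \<in> U" | "x \<in> - closure K" unfolding frontier_def U_def by auto
    then show ?case
    proof cases
      case 1
      then have "isCont f x" using cont oU continuous_on_eq_continuous_at by blast
      moreover have "\<forall>\<^sub>F y in nhds x. f y = f' y"
        using eventually_nhds_in_open[OF oU 1] by eventually_elim (simp add: f'_def)
      ultimately show ?thesis by (subst (asm) isCont_cong) auto
    next
      case 2
      have "\<forall>\<^sub>F y in nhds x. 0 = f' y"
      proof -
        have "\<forall>\<^sub>F y in nhds x. y \<in> - closure K"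
          by (rule eventually_nhds_in_open[OF _ 2]) (rule open_Compl[OF closed_closure])
        then show ?thesis
        proof eventually_elim
          case (elim y)
          then have "y \<notin> U" using interior_subset[of K] closure_subset[of K] unfolding U_def by blast
          then show ?case unfolding f'_def by simp
        qed
      qed
      moreover have "isCont (\<lambda>_. 0::real) x" by simp
      ultimately show ?thesis by (subst (asm) isCont_cong) auto
    qed
  qed
  moreover have "\<exists>A a. A > 0 \<and> a > 0 \<and> (\<forall>x. f' x \<le> A * exp (- a * norm x))"
  proof (cases "U = {}")
    case True
    then show ?thesis unfolding f'_def by (intro exI[of _ 1]) auto
  next
    case False
    then obtain A a where "A > 0" "a > 0" "\<And>x. f x \<le> A * exp (- a * norm x)"
      using log_concave_exp_decay[OF f int] unfolding U_def K_def by blast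
    moreover have "f' x \<le> f x" for x unfolding f'_def using f0[of x] by (simp add: indicator_def)
    ultimately show ?thesis by (meson order_trans)
  qed
  ultimately show ?thesis using that by blast
qed

section \<open>Existence of a maximal position\<close>

lemma norm_matrix_vector_le:
  fixes S :: "real^'n^'n"
  assumes S: "\<And>i j. \<bar>S $ i $ j\<bar> \<le> K"
  shows "norm (S *v x) \<le> real CARD('n) * (real CARD('n) * K) * norm x"
    and "norm S \<le> real CARD('n) * (real CARD('n) * K)"
proof -
  have row: "norm (S $ i) \<le> real CARD('n) * K" for i
  proof -
    have "norm (S $ i) \<le> (\<Sum>j\<in>UNIV. \<bar>S $ i $ j\<bar>)" by (rule norm_le_l1_cart)
    also have "\<dots> \<le> (\<Sum>j\<in>(UNIV::'n set). K)" by (intro sum_mono S)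
    finally show ?thesis by simp
  qed
  have "norm (S *v x) \<le> (\<Sum>i\<in>UNIV. \<bar>(S *v x) $ i\<bar>)" by (rule norm_le_l1_cart)
  also have "\<dots> \<le> (\<Sum>i\<in>(UNIV::'n set). real CARD('n) * K * norm x)"
  proof (rule sum_mono)
    fix i
    have "\<bar>(S *v x) $ i\<bar> \<le> norm (S $ i) * norm x"
      unfolding matrix_vector_mul_component by (rule Cauchy_Schwarz_ineq2)
    also have "\<dots> \<le> real CARD('n) * K * norm x" by (intro mult_right_mono row) auto
    finally show "\<bar>(S *v x) $ i\<bar> \<le> real CARD('n) * K * norm x" .
  qed
  finally show "norm (S *v x) \<le> real CARD('n) * (real CARD('n) * K) * norm x" by simp
  have "norm S \<le> (\<Sum>i\<in>UNIV. norm (S $ i))" unfolding norm_vec_def[of S] by (rule L2_set_le_sum) simp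
  also have "\<dots> \<le> (\<Sum>i\<in>(UNIV::'n set). real CARD('n) * K)" by (intro sum_mono row)
  finally show "norm S \<le> real CARD('n) * (real CARD('n) * K)" by simp
qed

text \<open>
  Coercivity and continuity. The fact \<open>entry\<close> controls the entries of \<open>S\<close>, the fact \<open>shift\<close> controls \<open>c\<close>
  once \<open>S\<close> is bounded; both bound the overlap by the reciprocal of the quantity to be controlled. Continuity is dominated
  convergence with majorant \<open>A f\<close>: the parameters occur in the argument of the continuous factor \<open>g\<close> alone.
\<close>

lemma affine_overlap_maximizer:
  fixes f g :: "real^'n \<Rightarrow> real"
  assumes f[measurable]: "f \<in> borel_measurable borel" and f0: "\<And>x. 0 \<le> f x"
    and fA: "\<And>x. f x \<le> A * exp (- a * norm x)"
    and g: "continuous_on UNIV g" and g0: "\<And>x. 0 < g x" and gA: "\<And>x. g x \<le> A * exp (- a * norm x)"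
    and a: "a > 0"
  shows "\<exists>S c. det S = 1 \<and> (\<forall>S' c'. det S' = 1 \<longrightarrow>
    (\<integral>x. f x * g (S' *v x + c') \<partial>lborel) \<le> (\<integral>x. f x * g (S *v x + c) \<partial>lborel))"
proof -
  define G where "G S c = (\<integral>x. f x * g (S *v x + c) \<partial>lborel)" for S :: "real^'n^'n" and c
  have A: "A > 0" using less_le_trans[OF g0 gA, of 0] by simp
  have gA': "g x \<le> A" for x
  proof -
    have "A * exp (- a * norm x) \<le> A * 1" using A a by (intro mult_left_mono) auto
    then show ?thesis using gA[of x] by linarith
  qed
  have ia: "integrable lborel (\<lambda>x::real^'n. exp (- b * norm x))" if "b > 0" for b
    by (rule integrable_exp_norm[OF that])
  have fi: "integrable lborel f"
    by (rule Bochner_Integration.integrable_bound[OF integrable_mult_right[OF ia[OF a], of A]])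
       (use f0 fA A in \<open>auto intro!: AE_I2\<close>)
  have cg: "continuous_on B (\<lambda>x. g (h x))" if "continuous_on B h" for B :: "'b::topological_space set" and h
    by (rule continuous_on_compose2[OF g that]) auto
  have caff: "continuous_on UNIV (\<lambda>x::real^'n. S *v x + c)" for S :: "real^'n^'n" and c
    by (intro continuous_intros linear_continuous_on) (simp add: linear_linear)
  have gm[measurable]: "(\<lambda>x. g (S *v x + c)) \<in> borel_measurable borel" for S :: "real^'n^'n" and c
    by (intro borel_measurable_continuous_onI cg caff)
  have Gi: "integrable lborel (\<lambda>x. f x * g (S *v x + c))" for S c
  proof (rule Bochner_Integration.integrable_bound[OF integrable_mult_right[OF fi, of A]])
    show "AE x in lborel. norm (f x * g (S *v x + c)) \<le> norm (A * f x)"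
    proof (rule AE_I2)
      fix x
      have "f x * g (S *v x + c) \<le> f x * A" by (intro mult_left_mono gA' f0)
      then show "norm (f x * g (S *v x + c)) \<le> norm (A * f x)"
        using f0[of x] less_imp_le[OF g0[of "S *v x + c"]] A by (simp add: abs_mult mult.commute)
    qed
  qed measurable
  have Gbd: "G S c \<le> M" if "(\<integral>\<^sup>+x. ennreal (f x * g (S *v x + c)) \<partial>lborel) \<le> ennreal M" "M \<ge> 0" for S c M
    using nn_integral_eq_integral[OF Gi[of S c]] that f0 g0
    unfolding G_def by (simp add: less_imp_le)
  define I where "I b = (\<integral>(x::real^'n). exp (- b * norm x) \<partial>lborel)" for b
  have I0: "I b \<ge> 0" for b unfolding I_def by simp
  have I: "(\<integral>\<^sup>+(x::real^'n). ennreal (exp (- b * norm x)) \<partial>lborel) = ennreal (I b)" if "b > 0" for b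
    unfolding I_def by (rule nn_integral_eq_integral[OF ia[OF that]]) simp
  have fg: "f x * g y \<le> A\<^sup>2 * exp (- a * (norm x + norm y))" for x y
  proof -
    have "f x * g y \<le> (A * exp (- a * norm x)) * (A * exp (- a * norm y))"
      using f0[of x] fA[of x] less_imp_le[OF g0[of y]] gA[of y] A by (intro mult_mono) auto
    also have "\<dots> = A\<^sup>2 * exp (- a * (norm x + norm y))"
      by (simp add: power2_eq_square algebra_simps flip: exp_add)
    finally show ?thesis .
  qed
  have entry: "G S c * \<bar>S $ i $ j\<bar> \<le> A\<^sup>2 * I a" for S c i j
  proof (cases "S $ i $ j = 0")
    case True
    then show ?thesis using I0 by simp
  next
    case False
    define e where "e = (axis j 1 :: real^'n)"
    have e: "e \<in> Basis" unfolding e_def by simp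
    \<comment> \<open>the coordinate \<open>x \<bullet> e\<close> is replaced by the \<open>i\<close>-th coordinate of \<open>S x + c\<close>\<close>
    define L where "L x = x + (S $ i \<bullet> x - x \<bullet> e + c $ i) *\<^sub>R e" for x
    have wj: "S $ i \<bullet> e = S $ i $ j" unfolding e_def by (simp add: inner_axis)
    have L: "norm (L x) \<le> norm x + norm (S *v x + c)" for x
    proof -
      have "L x = (x - (x \<bullet> e) *\<^sub>R e) + ((S *v x + c) $ i) *\<^sub>R e"
        unfolding L_def by (simp add: matrix_vector_mul_component algebra_simps)
      then have "norm (L x) \<le> norm (x - (x \<bullet> e) *\<^sub>R e) + norm (((S *v x + c) $ i) *\<^sub>R e)"
        using norm_triangle_ineq by metis
      also have "norm (((S *v x + c) $ i) *\<^sub>R e) \<le> norm (S *v x + c)"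
        using component_le_norm_cart[of "S *v x + c" i] e by simp
      also have "norm (x - (x \<bullet> e) *\<^sub>R e) \<le> norm x"
      proof -
        have "e \<bullet> e = 1" using e by (simp add: inner_Basis)
        then have "(norm (x - (x \<bullet> e) *\<^sub>R e))\<^sup>2 = (norm x)\<^sup>2 - (x \<bullet> e)\<^sup>2"
          unfolding power2_norm_eq_inner by (simp add: algebra_simps inner_commute power2_eq_square)
        then have "(norm (x - (x \<bullet> e) *\<^sub>R e))\<^sup>2 \<le> (norm x)\<^sup>2" by simp
        then show ?thesis by (rule power2_le_imp_le) simp
      qed
      finally show ?thesis by simp
    qed
    have "(\<integral>\<^sup>+x. ennreal (f x * g (S *v x + c)) \<partial>lborel) \<le> (\<integral>\<^sup>+x. ennreal (A\<^sup>2) * ennreal (exp (- a * norm (L x))) \<partial>lborel)"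
    proof (rule nn_integral_mono)
      fix x
      have "f x * g (S *v x + c) \<le> A\<^sup>2 * exp (- a * (norm x + norm (S *v x + c)))" by (rule fg)
      also have "\<dots> \<le> A\<^sup>2 * exp (- a * norm (L x))" using L[of x] a by (intro mult_left_mono) auto
      finally show "ennreal (f x * g (S *v x + c)) \<le> ennreal (A\<^sup>2) * ennreal (exp (- a * norm (L x)))"
        by (simp add: ennreal_leI flip: ennreal_mult')
    qed
    also have "\<dots> = ennreal (A\<^sup>2) * (\<integral>\<^sup>+x. ennreal (exp (- a * norm (L x))) \<partial>lborel)"
      unfolding L_def by (rule nn_integral_cmult) measurable
    also have "(\<integral>\<^sup>+x. ennreal (exp (- a * norm (L x))) \<partial>lborel) = ennreal (I a) / ennreal \<bar>S $ i $ j\<bar>"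
      unfolding L_def I[OF a, symmetric] wj[symmetric]
      by (rule nn_integral_coordinate_substitution) (use e wj False in auto)
    also have "ennreal (A\<^sup>2) * (ennreal (I a) / ennreal \<bar>S $ i $ j\<bar>) = ennreal (A\<^sup>2 * (I a / \<bar>S $ i $ j\<bar>))"
      using False I0 by (subst divide_ennreal) (auto simp: ennreal_mult' [symmetric])
    finally have "G S c \<le> A\<^sup>2 * (I a / \<bar>S $ i $ j\<bar>)" by (rule Gbd) (use I0 in auto)
    then show ?thesis using False by (simp add: field_simps)
  qed
  have shift: "G S c * norm c \<le> (2 * K / a) * (A\<^sup>2 * I (a / 2))"
    if K: "K \<ge> 1" "\<And>x. norm (S *v x) \<le> K * norm x" for S c K
  proof -
    \<comment> \<open>the decay in \<open>S x + c\<close> and half of that in \<open>x\<close> pay for \<open>exp (- s)\<close>, the other half keeps the integral finite\<close>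
    define s where "s = a * (norm c / (2 * K))"
    have s0: "s \<ge> 0" unfolding s_def using a K(1) by simp
    have "(\<integral>\<^sup>+x. ennreal (f x * g (S *v x + c)) \<partial>lborel)
      \<le> (\<integral>\<^sup>+(x::real^'n). ennreal (A\<^sup>2 * exp (- s)) * ennreal (exp (- (a / 2) * norm x)) \<partial>lborel)"
    proof (rule nn_integral_mono)
      fix x
      have "norm c \<le> norm (S *v x + c) + norm (S *v x)"
        using norm_triangle_ineq4[of "S *v x + c" "S *v x"] by simp
      also have "\<dots> \<le> norm (S *v x + c) + K * norm x" using K(2)[of x] by simp
      also have "\<dots> \<le> K * (2 * norm (S *v x + c)) + K * norm x"
      proof -
        have "1 * norm (S *v x + c) \<le> K * norm (S *v x + c)"
          using K(1) by (intro mult_right_mono) auto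
        moreover have "0 \<le> K * norm (S *v x + c)" using K(1) by simp
        moreover have "K * (2 * norm (S *v x + c)) = K * norm (S *v x + c) + K * norm (S *v x + c)" by simp
        ultimately show ?thesis by linarith
      qed
      finally have "norm c / (2 * K) \<le> norm (S *v x + c) + norm x / 2"
        using K(1) by (simp add: field_simps)
      then have "a * (norm c / (2 * K) + norm x / 2) \<le> a * (norm x + norm (S *v x + c))"
        using a by (intro mult_left_mono) auto
      then have le: "- a * (norm x + norm (S *v x + c)) \<le> - s + - (a / 2) * norm x"
        unfolding s_def by (simp add: algebra_simps)
      have "f x * g (S *v x + c) \<le> A\<^sup>2 * exp (- a * (norm x + norm (S *v x + c)))" by (rule fg)
      also have "\<dots> \<le> A\<^sup>2 * exp (- s + - (a / 2) * norm x)"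
        using le by (intro mult_left_mono) auto
      also have "\<dots> = A\<^sup>2 * exp (- s) * exp (- (a / 2) * norm x)" by (simp only: exp_add mult.assoc)
      finally show "ennreal (f x * g (S *v x + c)) \<le> ennreal (A\<^sup>2 * exp (- s)) * ennreal (exp (- (a / 2) * norm x))"
        by (simp add: ennreal_leI flip: ennreal_mult')
    qed
    also have "\<dots> = ennreal (A\<^sup>2 * exp (- s)) * ennreal (I (a / 2))"
      using I[of "a / 2"] a by (subst nn_integral_cmult) auto
    also have "\<dots> = ennreal (A\<^sup>2 * exp (- s) * I (a / 2))"
      using I0 by (simp add: ennreal_mult)
    finally have le: "G S c \<le> A\<^sup>2 * exp (- s) * I (a / 2)" by (rule Gbd) (use I0 in auto)
    have "G S c * norm c \<le> A\<^sup>2 * exp (- s) * I (a / 2) * norm c"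
      by (intro mult_right_mono le) auto
    also have "\<dots> = (2 * K / a) * (A\<^sup>2 * I (a / 2)) * (s * exp (- s))"
      unfolding s_def using a K(1) by (simp add: field_simps)
    also have "\<dots> \<le> (2 * K / a) * (A\<^sup>2 * I (a / 2)) * 1"
    proof (rule mult_left_mono)
      have "s \<le> exp s" using exp_ge_add_one_self[of s] by linarith
      then show "s * exp (- s) \<le> 1" by (simp add: exp_minus field_simps)
    qed (use a K(1) I0 in auto)
    finally show ?thesis by simp
  qed
  have Gcont: "continuous_on UNIV (\<lambda>q. G (fst q) (snd q))"
  proof (rule continuous_on_sequentiallyI)
    fix u :: "nat \<Rightarrow> (real^'n^'n) \<times> (real^'n)" and q
    assume u: "u \<longlonglongrightarrow> q"
    show "(\<lambda>k. G (fst (u k)) (snd (u k))) \<longlonglongrightarrow> G (fst q) (snd q)"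
      unfolding G_def
    proof (rule integral_dominated_convergence[where w = "\<lambda>x. A * f x"])
      show "integrable lborel (\<lambda>x. A * f x)" using fi by simp
      show "AE x in lborel. norm (f x * g (fst (u k) *v x + snd (u k))) \<le> A * f x" for k
        using f0 less_imp_le[OF g0] mult_left_mono[OF gA' f0] by (intro AE_I2) (simp add: abs_mult mult.commute[of A])
      show "AE x in lborel. (\<lambda>k. f x * g (fst (u k) *v x + snd (u k))) \<longlonglongrightarrow> f x * g (fst q *v x + snd q)"
      proof (rule AE_I2, rule tendsto_mult_left)
        fix x :: "real^'n"
        have "continuous_on UNIV (\<lambda>q. g (fst q *v x + snd q))"
          unfolding matrix_vector_mult_def
          by (intro cg continuous_intros continuous_on_vec_lambda)
        then show "(\<lambda>k. g (fst (u k) *v x + snd (u k))) \<longlonglongrightarrow> g (fst q *v x + snd q)"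
          using u by (auto dest: continuous_on_tendsto_compose)
      qed
    qed measurable
  qed
  define m where "m = G (mat 1) 0"
  show ?thesis
  proof (cases "m > 0")
    case False
    have "(\<integral>x. f x * g x \<partial>lborel) = 0"
    proof (rule antisym)
      show "(\<integral>x. f x * g x \<partial>lborel) \<le> 0" using False unfolding m_def G_def by simp
      show "0 \<le> (\<integral>x. f x * g x \<partial>lborel)"
        using f0 less_imp_le[OF g0] by (intro Bochner_Integration.integral_nonneg mult_nonneg_nonneg)
    qed
    then have "AE x in lborel. f x * g x = 0"
      using Gi[of "mat 1" 0] f0 g0 by (subst (asm) integral_nonneg_eq_0_iff_AE) (auto simp: less_imp_le)
    then have fz: "AE x in lborel. f x = 0"
      by eventually_elim (use g0 in \<open>auto simp: less_le\<close>)
    have z: "(\<integral>x. f x * g (S *v x + c) \<partial>lborel) = 0" for S c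
      by (rule integral_eq_zero_AE) (use fz in eventually_elim, simp)
    show ?thesis unfolding z by (intro exI[of _ "mat 1"]) auto
  next
    case True
    define Q where "Q = {q. det (fst q) = 1 \<and> m \<le> G (fst q) (snd q)}"
    have "closed Q"
    proof -
      have "continuous_on UNIV (\<lambda>q::(real^'n^'n) \<times> (real^'n). det (fst q))"
        unfolding det_def by (intro continuous_intros)
      then have "closed ((\<lambda>q::(real^'n^'n) \<times> (real^'n). det (fst q)) -` {1} \<inter> (\<lambda>q. G (fst q) (snd q)) -` {m..})"
        by (intro closed_Int closed_vimage Gcont) auto
      moreover have "Q = (\<lambda>q. det (fst q)) -` {1} \<inter> (\<lambda>q. G (fst q) (snd q)) -` {m..}"
        unfolding Q_def by auto
      ultimately show ?thesis by simp
    qed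
    moreover have "bounded Q"
    proof -
      define n where "n = real CARD('n)"
      define E where "E = A\<^sup>2 * I a / m"
      define K where "K = n * (n * E) + 1"
      have E0: "E \<ge> 0" unfolding E_def using I0 True by simp
      have "norm q \<le> n * (n * E) + (2 * K / a) * (A\<^sup>2 * I (a / 2)) / m" if "q \<in> Q" for q
      proof -
        obtain S c where q: "q = (S, c)" by fastforce
        have mG: "m \<le> G S c" using that unfolding Q_def q by simp
        have ent: "\<bar>S $ i $ j\<bar> \<le> E" for i j
        proof -
          have "m * \<bar>S $ i $ j\<bar> \<le> G S c * \<bar>S $ i $ j\<bar>" by (intro mult_right_mono mG) auto
          also have "\<dots> \<le> A\<^sup>2 * I a" by (rule entry)
          finally show ?thesis unfolding E_def using True by (simp add: field_simps)
        qed
        note bds = norm_matrix_vector_le[OF ent, folded n_def]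
        have "norm (S *v x) \<le> K * norm x" for x
          using bds(1)[of x] unfolding K_def by (simp add: distrib_right add_increasing2)
        moreover have "K \<ge> 1" unfolding K_def using E0 by (simp add: n_def)
        ultimately have "G S c * norm c \<le> (2 * K / a) * (A\<^sup>2 * I (a / 2))" by (intro shift) auto
        moreover have "m * norm c \<le> G S c * norm c" by (intro mult_right_mono mG) auto
        ultimately have "m * norm c \<le> (2 * K / a) * (A\<^sup>2 * I (a / 2))" by linarith
        then have "norm c \<le> (2 * K / a) * (A\<^sup>2 * I (a / 2)) / m"
          by (subst pos_le_divide_eq[OF True]) (simp only: mult.commute)
        moreover have "norm q \<le> norm S + norm c" unfolding q by (rule norm_Pair_le)
        ultimately show ?thesis using bds(2) by linarith
      qed
      then show ?thesis unfolding bounded_iff by blast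
    qed
    ultimately have "compact Q" by (simp add: compact_eq_bounded_closed)
    moreover have I1: "(mat 1, 0) \<in> Q" unfolding Q_def m_def by simp
    ultimately obtain q where q: "q \<in> Q" "\<And>q'. q' \<in> Q \<Longrightarrow> G (fst q') (snd q') \<le> G (fst q) (snd q)"
      using continuous_attains_sup[of Q "\<lambda>q. G (fst q) (snd q)"] continuous_on_subset[OF Gcont] by blast
    have "G S c \<le> G (fst q) (snd q)" if "det S = 1" for S c
    proof (cases "m \<le> G S c")
      case True
      then show ?thesis using q(2)[of "(S, c)"] that unfolding Q_def by simp
    next
      case False
      then show ?thesis using q(1) unfolding Q_def by simp
    qed
    then show ?thesis using q(1) unfolding G_def Q_def by blast
  qed
qed

section \<open>Almost everywhere differentiability of convex functions\<close>

lemma gradient_eq: "GDERIV p x :> D \<Longrightarrow> gradient p x = D"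
  unfolding gradient_def
proof (rule the_equality)
  fix D' assume D: "GDERIV p x :> D" and D': "GDERIV p x :> D'"
  have "(\<lambda>h. h \<bullet> D') = (\<lambda>h. h \<bullet> D)"
    using has_derivative_unique[OF D'[unfolded gderiv_def] D[unfolded gderiv_def]] .
  then have "\<forall>h. h \<bullet> D' = h \<bullet> D" by (simp add: fun_eq_iff)
  then show "D' = D" by (simp add: vector_eq_ldot)
qed

lemma gderiv_directional:
  fixes p :: "'a::real_inner \<Rightarrow> real"
  assumes "GDERIV p x :> D"
  shows "((\<lambda>h. (p (x + h *\<^sub>R v) - p x) / h) \<longlongrightarrow> v \<bullet> D) (at 0)"
proof -
  have "(p has_derivative (\<lambda>h. h \<bullet> D)) (at (x + 0 *\<^sub>R v))"
    using assms by (simp add: gderiv_def)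
  then have "((\<lambda>h. p (x + h *\<^sub>R v)) has_derivative (\<lambda>h. (h *\<^sub>R v) \<bullet> D)) (at 0)"
    by (rule has_derivative_compose[rotated]) (auto intro!: derivative_eq_intros)
  moreover have "(\<lambda>h. (h *\<^sub>R v) \<bullet> D) = (*) (v \<bullet> D)" by (simp add: fun_eq_iff mult.commute)
  ultimately have "DERIV (\<lambda>h. p (x + h *\<^sub>R v)) 0 :> v \<bullet> D"
    by (simp add: has_field_derivative_def)
  then show ?thesis by (simp add: DERIV_def)
qed

lemma gderiv_exp_minus:
  fixes p :: "'a::real_inner \<Rightarrow> real"
  assumes "GDERIV p x :> D"
  shows "GDERIV (\<lambda>x. exp (- p x)) x :> (- exp (- p x)) *\<^sub>R D"
proof -
  have "DERIV (\<lambda>t. exp (- t)) (p x) :> - exp (- p x)"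
    by (auto intro!: derivative_eq_intros)
  then show ?thesis by (rule GDERIV_DERIV_compose[OF assms])
qed

lemma convex_slope_mono:
  fixes p :: "'a::real_vector \<Rightarrow> real"
  assumes p: "convex_on UNIV p" and hk: "0 < h" "h \<le> k"
  shows "(p (x + h *\<^sub>R v) - p x) / h \<le> (p (x + k *\<^sub>R v) - p x) / k"
proof -
  have e: "x + h *\<^sub>R v = (1 - h / k) *\<^sub>R x + (h / k) *\<^sub>R (x + k *\<^sub>R v)"
    using hk by (simp add: algebra_simps)
  have "p (x + h *\<^sub>R v) \<le> (1 - h / k) * p x + (h / k) * p (x + k *\<^sub>R v)"
    unfolding e using hk by (intro convex_onD[OF p]) auto
  then show ?thesis using hk by (simp add: field_simps)
qed

lemma convex_midpoint:
  fixes p :: "'a::real_vector \<Rightarrow> real"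
  assumes p: "convex_on UNIV p"
  shows "2 * p x \<le> p (x + v) + p (x - v)"
proof -
  have e: "x = (1 - 1/2) *\<^sub>R (x + v) + (1/2) *\<^sub>R (x - v)" by (simp add: algebra_simps flip: scaleR_add_left)
  have "p x \<le> (1 - 1/2) * p (x + v) + (1/2) * p (x - v)"
    by (subst e, intro convex_onD[OF p]) auto
  then show ?thesis by simp
qed

text \<open>
  A majorant for the difference quotients that is continuous in \<open>x\<close> and does not involve \<open>h\<close>, which saves the
  discussion of local Lipschitz constants.
\<close>

lemma convex_increment_bound:
  fixes p :: "'a::real_vector \<Rightarrow> real"
  assumes p: "convex_on UNIV p" and h: "\<bar>h\<bar> \<le> 1"
  shows "\<bar>p (x + h *\<^sub>R v) - p x\<bar> \<le> \<bar>h\<bar> * (\<bar>p (x + v) - p x\<bar> + \<bar>p (x - v) - p x\<bar>)"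
proof -
  have up: "p (x + h *\<^sub>R u) - p x \<le> h * (p (x + u) - p x)" if "0 \<le> h" "h \<le> 1" for h u
    using convex_slope_mono[OF p, of h 1 x u] that by (cases "h = 0") (auto simp: field_simps)
  have *: "\<bar>p (x + h *\<^sub>R u) - p x\<bar> \<le> h * (\<bar>p (x + u) - p x\<bar> + \<bar>p (x - u) - p x\<bar>)" if h: "0 \<le> h" "h \<le> 1" for h u
  proof -
    have "p (x + h *\<^sub>R u) - p x \<le> h * \<bar>p (x + u) - p x\<bar>"
      using up[OF h, of u] mult_left_mono[OF abs_ge_self h(1), of "p (x + u) - p x"] by linarith
    moreover have "p (x - h *\<^sub>R u) - p x \<le> h * \<bar>p (x - u) - p x\<bar>"
      using up[OF h, of "-u"] mult_left_mono[OF abs_ge_self h(1), of "p (x - u) - p x"] by simp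
    moreover have "2 * p x \<le> p (x + h *\<^sub>R u) + p (x - h *\<^sub>R u)" by (rule convex_midpoint[OF p])
    moreover have "0 \<le> h * \<bar>p (x + u) - p x\<bar>" "0 \<le> h * \<bar>p (x - u) - p x\<bar>" using h by auto
    ultimately show ?thesis unfolding distrib_left abs_le_iff by linarith
  qed
  show ?thesis
  proof (cases "h \<ge> 0")
    case True then show ?thesis using *[of h v] h by simp
  next
    case False then show ?thesis using *[of "-h" "-v"] h by (simp add: add.commute)
  qed
qed

text \<open>
  The forward slopes decrease and the backward slopes increase as the step tends to \<open>0\<close>, and every
  backward slope is at most every forward slope. When their difference, the second difference quotient,
  tends to \<open>0\<close>, both have the same limit, the infimum of the forward slopes.
\<close>

lemma convex_two_sided_slope:
  fixes p :: "'a::real_vector \<Rightarrow> real"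
  assumes p: "convex_on UNIV p"
    and lim: "(\<lambda>k::nat. (p (x + (1 / (real k + 1)) *\<^sub>R v) + p (x - (1 / (real k + 1)) *\<^sub>R v) - 2 * p x) / (1 / (real k + 1))) \<longlonglongrightarrow> 0"
  shows "\<exists>d. \<forall>\<epsilon>>0. \<forall>\<^sub>F h in nhds 0. \<bar>p (x + h *\<^sub>R v) - p x - h * d\<bar> \<le> \<epsilon> * \<bar>h\<bar>"
proof -
  define R where "R = (\<lambda>h. (p (x + h *\<^sub>R v) - p x) / h)"
  define L where "L = (\<lambda>h. - ((p (x - h *\<^sub>R v) - p x) / h))"
  have Rm: "R h \<le> R k" if "0 < h" "h \<le> k" for h k
    unfolding R_def by (rule convex_slope_mono[OF p that])
  have Lm: "L k \<le> L h" if "0 < h" "h \<le> k" for h k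
    unfolding L_def using convex_slope_mono[OF p that, of x "-v"] by simp
  have LR: "L h \<le> R h" if "0 < h" for h
  proof -
    have "0 \<le> (p (x + h *\<^sub>R v) + p (x - h *\<^sub>R v) - 2 * p x) / h"
      using convex_midpoint[OF p, of x "h *\<^sub>R v"] that by simp
    then show ?thesis unfolding L_def R_def by (simp add: diff_divide_distrib add_divide_distrib)
  qed
  have LR2: "L h \<le> R k" if "0 < h" "0 < k" for h k
    using LR[of "min h k"] Lm[of "min h k" h] Rm[of "min h k" k] that by auto
  define d where "d = (INF h\<in>{0<..}. R h)"
  have dR: "d \<le> R h" if "0 < h" for h
    unfolding d_def by (rule cINF_lower[OF bdd_belowI2[of _ "L 1"]]) (use LR2 that in auto)
  have Ld: "L h \<le> d" if "0 < h" for h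
    unfolding d_def by (rule cINF_greatest) (use LR2 that in auto)
  show ?thesis
  proof (intro exI[of _ d] allI impI)
    fix \<epsilon> :: real assume \<epsilon>: "\<epsilon> > 0"
    obtain k :: nat where k: "(p (x + (1 / (real k + 1)) *\<^sub>R v) + p (x - (1 / (real k + 1)) *\<^sub>R v) - 2 * p x) / (1 / (real k + 1)) < \<epsilon>"
      using order_tendstoD(2)[OF lim \<epsilon>] by (auto simp: eventually_sequentially)
    define \<delta> where "\<delta> = 1 / (real k + 1)"
    have \<delta>: "\<delta> > 0" unfolding \<delta>_def by simp
    have gap: "R \<delta> - L \<delta> < \<epsilon>"
      using k unfolding \<delta>_def[symmetric] R_def L_def by (simp add: diff_divide_distrib add_divide_distrib)
    have pos: "\<bar>R h - d\<bar> \<le> \<epsilon>" "\<bar>L h - d\<bar> \<le> \<epsilon>" if "0 < h" "h \<le> \<delta>" for h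
      using Rm[OF that] Lm[OF that] dR[OF that(1)] Ld[OF that(1)] dR[OF \<delta>] Ld[OF \<delta>] gap by auto
    show "\<forall>\<^sub>F h in nhds 0. \<bar>p (x + h *\<^sub>R v) - p x - h * d\<bar> \<le> \<epsilon> * \<bar>h\<bar>"
      unfolding eventually_nhds_metric
    proof (intro exI[of _ \<delta>] conjI allI impI)
      fix h :: real assume "dist h 0 < \<delta>"
      then have h: "\<bar>h\<bar> < \<delta>" by simp
      consider "h = 0" | "h > 0" | "h < 0" by linarith
      then show "\<bar>p (x + h *\<^sub>R v) - p x - h * d\<bar> \<le> \<epsilon> * \<bar>h\<bar>"
      proof cases
        case 2
        have "p (x + h *\<^sub>R v) - p x - h * d = h * (R h - d)" unfolding R_def using 2 by (simp add: field_simps)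
        then show ?thesis using pos(1)[of h] 2 h by (simp add: abs_mult mult.commute)
      next
        case 3
        have "p (x + h *\<^sub>R v) - p x - h * d = h * (L (-h) - d)" unfolding L_def using 3 by (simp add: field_simps)
        then show ?thesis using pos(2)[of "-h"] 3 h by (simp add: abs_mult mult.commute)
      qed simp
    qed (rule \<delta>)
  qed
qed

text \<open>
  For a convex function two-sided partial derivatives give full differentiability: \<open>x + v\<close> is the mean of the
  points \<open>x + n v\<^sub>b b\<close> on the coordinate axes through \<open>x\<close>, so convexity bounds the increment from above by the
  partial increments, and midpoint convexity turns the upper bound at \<open>- v\<close> into the lower bound at \<open>v\<close>.
\<close>

lemma convex_partials_imp_gderiv:
  fixes p :: "'a::euclidean_space \<Rightarrow> real"
  assumes p: "convex_on UNIV p"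
    and d: "\<And>b \<epsilon>. b \<in> Basis \<Longrightarrow> \<epsilon> > 0 \<Longrightarrow> \<forall>\<^sub>F h in nhds 0. \<bar>p (x + h *\<^sub>R b) - p x - h * d b\<bar> \<le> \<epsilon> * \<bar>h\<bar>"
  shows "GDERIV p x :> (\<Sum>b\<in>Basis. d b *\<^sub>R b)"
  unfolding gderiv_def has_derivative_at_alt
proof (intro conjI allI impI)
  define D where "D = (\<Sum>b\<in>Basis. d b *\<^sub>R b)"
  define n where "n = real DIM('a)"
  have n: "n \<ge> 1" unfolding n_def by (simp add: Suc_leI)
  show "bounded_linear (\<lambda>h. h \<bullet> (\<Sum>b\<in>Basis. d b *\<^sub>R b))" by (rule bounded_linear_inner_left)
  fix e :: real assume e: "e > 0"
  have "\<forall>\<^sub>F h in nhds 0. \<forall>b\<in>Basis. \<bar>p (x + h *\<^sub>R b) - p x - h * d b\<bar> \<le> (e / n) * \<bar>h\<bar>"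
    by (rule eventually_ball_finite) (use d[of _ "e / n"] e n in auto)
  then obtain \<delta> where \<delta>: "\<delta> > 0"
    "\<And>h b. \<bar>h\<bar> < \<delta> \<Longrightarrow> b \<in> Basis \<Longrightarrow> \<bar>p (x + h *\<^sub>R b) - p x - h * d b\<bar> \<le> (e / n) * \<bar>h\<bar>"
    unfolding eventually_nhds_metric by auto
  have up: "p (x + v) - p x \<le> v \<bullet> D + e * norm v" if v: "norm v < \<delta> / n" for v
  proof -
    have ev: "x + v = (\<Sum>b\<in>Basis. (1 / n) *\<^sub>R (x + (n * (v \<bullet> b)) *\<^sub>R b))"
    proof -
      have "(\<Sum>b\<in>Basis. (1 / n) *\<^sub>R (x + (n * (v \<bullet> b)) *\<^sub>R b)) = (\<Sum>b\<in>(Basis::'a set). (1 / n) *\<^sub>R x) + (\<Sum>b\<in>Basis. (v \<bullet> b) *\<^sub>R b)"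
        using n by (simp add: scaleR_add_right sum.distrib)
      also have "(\<Sum>b\<in>(Basis::'a set). (1 / n) *\<^sub>R x) = x" using n by (simp add: n_def scaleR_conv_of_real[symmetric] sum_constant_scaleR)
      finally show ?thesis by (simp add: euclidean_representation)
    qed
    have "p (x + v) \<le> (\<Sum>b\<in>Basis. (1 / n) * p (x + (n * (v \<bullet> b)) *\<^sub>R b))"
      unfolding ev by (rule convex_on_sum[OF _ _ p]) (use n in \<open>auto simp: n_def\<close>)
    also have "\<dots> \<le> (\<Sum>b\<in>Basis. (1 / n) * p x + (v \<bullet> b) * d b + (e / n) * norm v)"
    proof (rule sum_mono)
      fix b :: 'a assume b: "b \<in> Basis"
      have vb: "\<bar>v \<bullet> b\<bar> \<le> norm v" by (rule Basis_le_norm[OF b])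
      have "\<bar>n * (v \<bullet> b)\<bar> < \<delta>"
      proof -
        have "\<bar>n * (v \<bullet> b)\<bar> \<le> n * norm v" using vb n by (simp add: abs_mult mult_left_mono)
        also have "\<dots> < \<delta>" using v n by (simp add: field_simps)
        finally show ?thesis .
      qed
      from \<delta>(2)[OF this b]
      have "p (x + (n * (v \<bullet> b)) *\<^sub>R b) \<le> p x + n * (v \<bullet> b) * d b + (e / n) * \<bar>n * (v \<bullet> b)\<bar>" by linarith
      also have "(e / n) * \<bar>n * (v \<bullet> b)\<bar> \<le> e * norm v" using n e vb by (simp add: abs_mult)
      finally have "(1 / n) * p (x + (n * (v \<bullet> b)) *\<^sub>R b) \<le> (1 / n) * (p x + n * (v \<bullet> b) * d b + e * norm v)"
        using n by (intro mult_left_mono) auto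
      also have "\<dots> = (1 / n) * p x + (v \<bullet> b) * d b + (e / n) * norm v" using n by (simp add: field_simps)
      finally show "(1 / n) * p (x + (n * (v \<bullet> b)) *\<^sub>R b) \<le> (1 / n) * p x + (v \<bullet> b) * d b + (e / n) * norm v" .
    qed
    also have "\<dots> = p x + v \<bullet> D + e * norm v"
      using n unfolding D_def by (simp add: sum.distrib inner_sum_right n_def mult.commute)
    finally show ?thesis by simp
  qed
  show "\<exists>da>0. \<forall>y. norm (y - x) < da \<longrightarrow>
          norm (p y - p x - (y - x) \<bullet> (\<Sum>b\<in>Basis. d b *\<^sub>R b)) \<le> e * norm (y - x)"
  proof (intro exI[of _ "\<delta> / n"] conjI allI impI)
    show "\<delta> / n > 0" using \<delta> n by simp
    fix y assume y: "norm (y - x) < \<delta> / n"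
    have "p y - p x \<le> (y - x) \<bullet> D + e * norm (y - x)" using up[OF y] by simp
    moreover have "p (x - (y - x)) - p x \<le> - ((y - x) \<bullet> D) + e * norm (y - x)"
    proof -
      have "p (x + - (y - x)) - p x \<le> - (y - x) \<bullet> D + e * norm (- (y - x))"
        by (rule up) (use y in \<open>simp only: norm_minus_cancel\<close>)
      then show ?thesis by (simp only: norm_minus_cancel inner_minus_left add_uminus_conv_diff)
    qed
    moreover have "2 * p x \<le> p (x + (y - x)) + p (x - (y - x))" by (rule convex_midpoint[OF p])
    ultimately show "norm (p y - p x - (y - x) \<bullet> (\<Sum>b\<in>Basis. d b *\<^sub>R b)) \<le> e * norm (y - x)"
      unfolding D_def[symmetric] real_norm_def abs_le_iff by (simp)
  qed
qed

text \<open>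
  The second difference quotients are nonnegative and decrease with the step. Tested against the Lipschitz cutoff
  \<open>\<eta>(x) = max 0 (R - |x|)\<close>, a translation moves one difference onto \<open>\<eta>\<close>, where it is of the order of the step,
  while the remaining first difference of \<open>p\<close> is also of that order. So the integrals tend to
  \<open>0\<close>, and by Fatou's lemma so do the quotients almost everywhere.
\<close>

lemma convex_second_difference_AE:
  fixes p :: "'a::euclidean_space \<Rightarrow> real" and v :: 'a
  assumes p: "convex_on UNIV p"
  shows "AE x in lborel. (\<lambda>k::nat. (p (x + (1 / (real k + 1)) *\<^sub>R v) + p (x - (1 / (real k + 1)) *\<^sub>R v) - 2 * p x) / (1 / (real k + 1))) \<longlonglongrightarrow> 0"
proof -
  define t :: "nat \<Rightarrow> real" where "t k = 1 / (real k + 1)" for k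
  have t: "0 < t k" "t k \<le> 1" for k unfolding t_def by auto
  define S where "S k x = (p (x + t k *\<^sub>R v) + p (x - t k *\<^sub>R v) - 2 * p x) / t k" for k x
  have cont: "continuous_on UNIV p" by (rule convex_on_continuous[OF open_UNIV p])
  have cp: "continuous_on A (\<lambda>x. p (f x))" if "continuous_on A f" for A :: "'a set" and f :: "'a \<Rightarrow> 'a"
    by (rule continuous_on_compose2[OF cont that]) auto
  have S0: "0 \<le> S k x" for k x
    unfolding S_def using convex_midpoint[OF p, of x "t k *\<^sub>R v"] t[of k] by simp
  have Sm: "decseq (\<lambda>k. S k x)" for x
  proof (rule decseq_SucI)
    fix k
    have "t (Suc k) \<le> t k" unfolding t_def by (simp add: frac_le)
    from convex_slope_mono[OF p t(1) this, of x v] convex_slope_mono[OF p t(1) this, of x "-v"]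
    show "S (Suc k) x \<le> S k x" unfolding S_def by (simp add: diff_divide_distrib add_divide_distrib)
  qed
  have SB[measurable]: "S k \<in> borel_measurable borel" for k
    unfolding S_def by (intro borel_measurable_continuous_onI continuous_intros cp) (use t[of k] in auto)
  have zero: "AE x in lborel. norm x < R \<longrightarrow> (\<lambda>k. S k x) \<longlonglongrightarrow> 0" for R :: real
  proof -
    define \<eta> where "\<eta> x = max 0 (R - norm x)" for x :: 'a
    have e0: "\<eta> x \<ge> 0" for x unfolding \<eta>_def by simp
    have ec: "continuous_on A \<eta>" for A unfolding \<eta>_def by (intro continuous_intros)
    have ecc: "continuous_on A (\<lambda>x. \<eta> (f x))" if "continuous_on A f" for A :: "'a set" and f :: "'a \<Rightarrow> 'a"
      by (rule continuous_on_compose2[OF ec[of UNIV] that]) auto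
    have eL: "\<bar>\<eta> x - \<eta> y\<bar> \<le> norm (x - y)" for x y
      unfolding \<eta>_def using norm_triangle_ineq3[of x y] by (auto simp: max_def)
    \<comment> \<open>\<open>K\<close> contains the supports of \<open>\<eta>\<close> and of all its translates that occur\<close>
    define K where "K = cball (0::'a) (\<bar>R\<bar> + norm v)"
    have eK: "\<eta> (x + c *\<^sub>R v) = 0" if "x \<notin> K" "\<bar>c\<bar> \<le> 1" for x c
    proof -
      have "norm x \<le> norm (x + c *\<^sub>R v) + norm (c *\<^sub>R v)" using norm_triangle_ineq4[of "x + c *\<^sub>R v" "c *\<^sub>R v"] by simp
      moreover have "norm (c *\<^sub>R v) \<le> norm v" using that(2) by (simp add: mult_left_le_one_le)
      ultimately have "norm (x + c *\<^sub>R v) > \<bar>R\<bar>" using that(1) unfolding K_def by simp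
      then show ?thesis unfolding \<eta>_def by simp
    qed
    have intK: "integrable lborel f" if "continuous_on UNIV f" "\<And>x. x \<notin> K \<Longrightarrow> f x = 0" for f :: "'a \<Rightarrow> real"
    proof -
      have "integrable lborel (\<lambda>x. indicator K x *\<^sub>R f x)"
        by (rule borel_integrable_compact) (use continuous_on_subset[OF that(1)] in \<open>auto simp: K_def\<close>)
      moreover have "indicator K x *\<^sub>R f x = f x" for x using that(2)[of x] by (cases "x \<in> K") auto
      ultimately show ?thesis by (simp only:)
    qed
    define G where "G x = \<bar>p (x + v) - p x\<bar> + \<bar>p (x - v) - p x\<bar>" for x
    define C where "C = (\<integral>x. indicator K x *\<^sub>R (norm v * G x) \<partial>lborel)"
    have Gi: "integrable lborel (\<lambda>x. indicator K x *\<^sub>R (norm v * G x))"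
      unfolding G_def by (rule borel_integrable_compact) (auto simp: K_def intro!: continuous_intros cp)
    have bd: "(\<integral>\<^sup>+ x. ennreal (\<eta> x * S k x) \<partial>lborel) \<le> ennreal (t k * C)" for k
    proof -
      define h where "h = t k"
      have h: "0 < h" "h \<le> 1" unfolding h_def by (rule t)+
      define U where "U x = p (x + h *\<^sub>R v) - p x" for x
      have Uc: "continuous_on A U" for A unfolding U_def by (intro continuous_intros cp)
      have Ucc: "continuous_on A (\<lambda>x. U (f x))" if "continuous_on A f" for A :: "'a set" and f :: "'a \<Rightarrow> 'a"
        by (rule continuous_on_compose2[OF Uc[of UNIV] that]) auto
      have i1: "integrable lborel (\<lambda>x. \<eta> x * U x)"
        by (intro intK continuous_intros ec Uc) (use eK[of _ 0] in auto)
      have i2: "integrable lborel (\<lambda>x. \<eta> (x + h *\<^sub>R v) * U x)"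
        by (intro intK continuous_intros ecc Uc) (use eK[of _ h] h in auto)
      have i3: "integrable lborel (\<lambda>x. \<eta> x * U (x - h *\<^sub>R v))"
        by (intro intK continuous_intros ec Ucc) (use eK[of _ 0] in auto)
      have sh: "(\<integral>x. \<eta> (x + h *\<^sub>R v) * U x \<partial>lborel) = (\<integral>x. \<eta> x * U (x - h *\<^sub>R v) \<partial>lborel)"
      proof -
        have "(\<integral>x. \<eta> x * U (x - h *\<^sub>R v) \<partial>lborel) = (\<integral>x. \<eta> x * U (x - h *\<^sub>R v) \<partial>distr lborel borel ((+) (h *\<^sub>R v)))"
          by (simp add: lborel_distr_plus)
        also have "\<dots> = (\<integral>x. \<eta> (h *\<^sub>R v + x) * U (h *\<^sub>R v + x - h *\<^sub>R v) \<partial>lborel)"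
          by (rule integral_distr) (auto intro!: borel_measurable_continuous_onI continuous_intros ec Ucc)
        finally show ?thesis by (simp add: add.commute)
      qed
      have eS: "\<eta> x * S k x = (\<eta> x * U x - \<eta> x * U (x - h *\<^sub>R v)) / h" for x
        unfolding S_def U_def h_def[symmetric] using h by (simp add: field_simps)
      have iS: "integrable lborel (\<lambda>x. \<eta> x * S k x)"
        unfolding eS using i1 i3 by simp
      have "(\<integral>x. \<eta> x * S k x \<partial>lborel) = ((\<integral>x. \<eta> x * U x \<partial>lborel) - (\<integral>x. \<eta> x * U (x - h *\<^sub>R v) \<partial>lborel)) / h"
        unfolding eS using i1 i3 by simp
      also have "\<dots> = (\<integral>x. (\<eta> x - \<eta> (x + h *\<^sub>R v)) * U x / h \<partial>lborel)"
        unfolding sh[symmetric] using i1 i2 by (simp add: left_diff_distrib)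
      also have "\<dots> \<le> (\<integral>x. h * (indicator K x *\<^sub>R (norm v * G x)) \<partial>lborel)"
      proof (rule integral_mono)
        show "integrable lborel (\<lambda>x. (\<eta> x - \<eta> (x + h *\<^sub>R v)) * U x / h)"
          using i1 i2 by (simp add: left_diff_distrib)
        show "integrable lborel (\<lambda>x. h * (indicator K x *\<^sub>R (norm v * G x)))"
          using Gi by simp
        fix x
        show "(\<eta> x - \<eta> (x + h *\<^sub>R v)) * U x / h \<le> h * (indicator K x *\<^sub>R (norm v * G x))"
        proof (cases "x \<in> K")
          case False
          then show ?thesis using eK[of x 0] eK[of x h] h by simp
        next
          case True
          have "(\<eta> x - \<eta> (x + h *\<^sub>R v)) * U x \<le> \<bar>\<eta> x - \<eta> (x + h *\<^sub>R v)\<bar> * \<bar>U x\<bar>"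
            by (metis abs_ge_self abs_mult)
          also have "\<dots> \<le> (h * norm v) * (h * G x)"
          proof (rule mult_mono)
            show "\<bar>\<eta> x - \<eta> (x + h *\<^sub>R v)\<bar> \<le> h * norm v" using eL[of x "x + h *\<^sub>R v"] h by simp
            show "\<bar>U x\<bar> \<le> h * G x"
              using convex_increment_bound[OF p, of h x v] h unfolding U_def G_def by simp
          qed (use h in auto)
          finally show ?thesis using True h by (simp add: field_simps)
        qed
      qed
      also have "\<dots> = h * C" unfolding C_def by simp
      finally have "(\<integral>x. \<eta> x * S k x \<partial>lborel) \<le> t k * C" unfolding h_def .
      then show ?thesis
        using nn_integral_eq_integral[OF iS] e0 S0 by (simp add: ennreal_leI)
    qed
    have tl: "(\<lambda>k. ennreal (t k * C)) \<longlonglongrightarrow> 0"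
    proof -
      have "t \<longlonglongrightarrow> 0" unfolding t_def by (rule LIMSEQ_one_over_Suc)
      then have "(\<lambda>k. t k * C) \<longlonglongrightarrow> 0 * C" by (intro tendsto_intros)
      then show ?thesis using tendsto_ennrealI by fastforce
    qed
    have "(\<integral>\<^sup>+ x. liminf (\<lambda>k. ennreal (\<eta> x * S k x)) \<partial>lborel) \<le> liminf (\<lambda>k. \<integral>\<^sup>+ x. ennreal (\<eta> x * S k x) \<partial>lborel)"
      by (rule nn_integral_liminf) (use borel_measurable_continuous_onI[OF ec] in measurable)
    also have "\<dots> \<le> liminf (\<lambda>k. ennreal (t k * C))"
      by (rule Liminf_mono) (use bd in auto)
    also have "\<dots> = 0" using tl by (simp add: lim_imp_Liminf)
    finally have "(\<integral>\<^sup>+ x. liminf (\<lambda>k. ennreal (\<eta> x * S k x)) \<partial>lborel) = 0" by simp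
    moreover have "(\<lambda>x. liminf (\<lambda>k. ennreal (\<eta> x * S k x))) \<in> borel_measurable lborel"
      using borel_measurable_continuous_onI[OF ec] by measurable
    ultimately have ae: "AE x in lborel. liminf (\<lambda>k. ennreal (\<eta> x * S k x)) = 0"
      by (simp add: nn_integral_0_iff_AE)
    show ?thesis using ae
    proof eventually_elim
      case (elim x)
      show ?case
      proof
        assume x: "norm x < R"
        obtain l where l: "(\<lambda>k. S k x) \<longlonglongrightarrow> l" "\<And>k. l \<le> S k x"
          using decseq_convergent[OF Sm[of x], of 0] S0 by auto
        have l0: "l \<ge> 0" using l(1) S0 by (intro LIMSEQ_le_const) auto
        have "(\<lambda>k. ennreal (\<eta> x * S k x)) \<longlonglongrightarrow> ennreal (\<eta> x * l)"
          by (intro tendsto_ennrealI tendsto_intros l)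
        then have "ennreal (\<eta> x * l) = 0" using elim by (simp add: lim_imp_Liminf)
        moreover have "\<eta> x > 0" using x unfolding \<eta>_def by simp
        ultimately have "l = 0" using l0 by (simp add: ennreal_eq_0_iff mult_le_0_iff)
        then show "(\<lambda>k. S k x) \<longlonglongrightarrow> 0" using l by simp
      qed
    qed
  qed
  have "AE x in lborel. \<forall>n::nat. norm x < real n \<longrightarrow> (\<lambda>k. S k x) \<longlonglongrightarrow> 0"
    unfolding AE_all_countable using zero by blast
  then show ?thesis
  proof eventually_elim
    case (elim x)
    obtain n :: nat where "norm x < real n" using reals_Archimedean2 by blast
    with elim show ?case unfolding S_def t_def by blast
  qed
qed

text \<open>
  Limits of difference quotients along the coordinate axes provide a Borel function that agrees with the
  gradient wherever the latter exists.
\<close>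

lemma convex_gradient_AE:
  fixes p :: "'a::euclidean_space \<Rightarrow> real"
  assumes p: "convex_on UNIV p"
  shows "\<exists>dp \<in> borel_measurable borel. AE x in lborel. GDERIV p x :> dp x"
proof -
  have cont: "continuous_on UNIV p" by (rule convex_on_continuous[OF open_UNIV p])
  have cp: "continuous_on A (\<lambda>x. p (f x))" if "continuous_on A f" for A :: "'a set" and f :: "'a \<Rightarrow> 'a"
    by (rule continuous_on_compose2[OF cont that]) auto
  define dp where "dp x = (\<Sum>b\<in>Basis. lim (\<lambda>k::nat. (p (x + (1 / (real k + 1)) *\<^sub>R b) - p x) / (1 / (real k + 1))) *\<^sub>R b)" for x
  have "dp \<in> borel_measurable borel"
    unfolding dp_def
    by (intro borel_measurable_sum borel_measurable_scaleR borel_measurable_lim_metric borel_measurable_const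
          borel_measurable_continuous_onI continuous_intros cp) auto
  moreover have "AE x in lborel. \<forall>b\<in>Basis. (\<lambda>k::nat. (p (x + (1 / (real k + 1)) *\<^sub>R b) + p (x - (1 / (real k + 1)) *\<^sub>R b) - 2 * p x) / (1 / (real k + 1))) \<longlonglongrightarrow> 0"
    by (intro AE_finite_allI convex_second_difference_AE[OF p]) simp
  then have "AE x in lborel. GDERIV p x :> dp x"
  proof eventually_elim
    case (elim x)
    have "\<forall>b\<in>Basis. \<exists>d. \<forall>\<epsilon>>0. \<forall>\<^sub>F h in nhds 0. \<bar>p (x + h *\<^sub>R b) - p x - h * d\<bar> \<le> \<epsilon> * \<bar>h\<bar>"
      using elim convex_two_sided_slope[OF p] by blast
    then obtain d where d: "\<forall>b\<in>Basis. \<forall>\<epsilon>>0. \<forall>\<^sub>F h in nhds 0. \<bar>p (x + h *\<^sub>R b) - p x - h * d b\<bar> \<le> \<epsilon> * \<bar>h\<bar>"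
      by (rule bchoice[THEN exE])
    define D where "D = (\<Sum>b\<in>Basis. d b *\<^sub>R b)"
    have G: "GDERIV p x :> D"
      unfolding D_def by (rule convex_partials_imp_gderiv[OF p]) (use d in blast)
    have "lim (\<lambda>k::nat. (p (x + (1 / (real k + 1)) *\<^sub>R b) - p x) / (1 / (real k + 1))) = D \<bullet> b" for b
    proof (rule limI)
      have "filterlim (\<lambda>k::nat. 1 / (real k + 1)) (at 0) sequentially"
        using LIMSEQ_one_over_Suc by (auto simp: filterlim_at)
      from filterlim_compose[OF gderiv_directional[OF G, of b] this]
      show "(\<lambda>k::nat. (p (x + (1 / (real k + 1)) *\<^sub>R b) - p x) / (1 / (real k + 1))) \<longlonglongrightarrow> D \<bullet> b"
        by (simp add: inner_commute)
    qed
    then have "dp x = D" unfolding dp_def by (simp add: euclidean_representation)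
    with G show ?case by simp
  qed
  ultimately show ?thesis by blast
qed

section \<open>First variation of the overlap\<close>

lemma exp_minus_diff_le:
  fixes a b B :: real
  assumes "exp (- a) \<le> B" "exp (- b) \<le> B"
  shows "\<bar>exp (- a) - exp (- b)\<bar> \<le> B * \<bar>a - b\<bar>"
proof -
  have *: "exp (- a) - exp (- b) \<le> B * (b - a)" if "a \<le> b" "exp (- a) \<le> B" for a b :: real
  proof -
    have "exp (- a) - exp (- b) = exp (- a) * (1 - exp (- (b - a)))"
      by (simp add: right_diff_distrib flip: exp_add)
    also have "\<dots> \<le> exp (- a) * (b - a)"
    proof (rule mult_left_mono)
      have "1 + - (b - a) \<le> exp (- (b - a))" by (rule exp_ge_add_one_self)
      then show "1 - exp (- (b - a)) \<le> b - a" by linarith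
    qed simp
    also have "\<dots> \<le> B * (b - a)" using that by (intro mult_right_mono) auto
    finally show ?thesis .
  qed
  show ?thesis using *[of a b] *[of b a] assms by (cases "a \<le> b") auto
qed

text \<open>
  A product of two square-integrable functions: the weight is at most a multiple of \<open>exp (- (b / 2) |x|)\<close>.
\<close>

lemma weighted_L2_integrable:
  fixes q :: "'a::euclidean_space \<Rightarrow> 'b::euclidean_space"
  assumes b: "b > 0" and q[measurable]: "q \<in> borel_measurable borel"
    and L2: "(\<integral>\<^sup>+ x. ennreal ((norm (q x))\<^sup>2) \<partial>lborel) < \<infinity>"
  shows "integrable lborel (\<lambda>x. exp (- b * norm x) * (1 + norm x) * norm (q x))"
proof (rule Bochner_Integration.integrable_bound)
  have i1: "integrable lborel (\<lambda>x. (norm (q x))\<^sup>2)"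
    using L2 by (intro integrableI_nonneg) auto
  have i2: "integrable lborel (\<lambda>x::'a. (1 + 2 / b)\<^sup>2 * exp (- b * norm x))"
    by (intro integrable_mult_right integrable_exp_norm b)
  show "integrable lborel (\<lambda>x. (norm (q x))\<^sup>2 + (1 + 2 / b)\<^sup>2 * exp (- b * norm x))"
    using i1 i2 by simp
  show "AE x in lborel. norm (exp (- b * norm x) * (1 + norm x) * norm (q x))
      \<le> norm ((norm (q x))\<^sup>2 + (1 + 2 / b)\<^sup>2 * exp (- b * norm x))"
  proof (rule AE_I2)
    fix x :: 'a
    define E where "E = exp (- (b / 2) * norm x)"
    have E: "E > 0" "exp (- b * norm x) = E * E" unfolding E_def by (auto simp flip: exp_add)
    have "(1 + norm x) * E \<le> (1 + 2 / b)"
    proof -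
      have "1 + norm x \<le> (1 + 2 / b) * (1 + (b / 2) * norm x)"
        using b by (simp add: field_simps)
      also have "\<dots> \<le> (1 + 2 / b) * exp ((b / 2) * norm x)"
        using b exp_ge_add_one_self by (intro mult_left_mono) auto
      finally have "(1 + norm x) * E \<le> (1 + 2 / b) * exp ((b / 2) * norm x) * E"
        using E by (intro mult_right_mono) auto
      also have "\<dots> = 1 + 2 / b" unfolding E_def mult.assoc by (simp flip: exp_add)
      finally show ?thesis .
    qed
    then have "((1 + norm x) * E) * (E * norm (q x)) \<le> (1 + 2 / b) * (E * norm (q x))"
      using E(1) by (intro mult_right_mono) auto
    then have "exp (- b * norm x) * (1 + norm x) * norm (q x) \<le> ((1 + 2 / b) * E) * norm (q x)"
      unfolding E(2) by (simp only: mult.assoc mult.left_commute mult.commute)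
    also have "\<dots> \<le> (norm (q x))\<^sup>2 + ((1 + 2 / b) * E)\<^sup>2"
    proof -
      have "2 * (((1 + 2 / b) * E) * norm (q x)) \<le> (norm (q x))\<^sup>2 + ((1 + 2 / b) * E)\<^sup>2"
        using sum_squares_bound[of "(1 + 2 / b) * E" "norm (q x)"] by simp
      moreover have "0 \<le> ((1 + 2 / b) * E) * norm (q x)" using b E by simp
      ultimately show ?thesis by linarith
    qed
    finally show "norm (exp (- b * norm x) * (1 + norm x) * norm (q x))
      \<le> norm ((norm (q x))\<^sup>2 + (1 + 2 / b)\<^sup>2 * exp (- b * norm x))"
      using E by (simp add: power_mult_distrib power2_eq_square[of E])
  qed
qed measurable

text \<open>
  Here \<open>F\<close> has compact support, so the bound of the difference quotients by a continuous function permits to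
  differentiate under the integral. The derivative is stated after the substitution \<open>y = x + t V(x)\<close>, in which
  \<open>F\<close> carries the parameter; its inverse is \<open>x = y - t V(y)\<close> because \<open>V\<close> is constant along its flow lines.
\<close>

lemma compact_overlap_has_derivative:
  fixes p :: "'a::euclidean_space \<Rightarrow> real" and dp V :: "'a \<Rightarrow> 'a" and F :: "'a \<Rightarrow> real"
  assumes p: "convex_on UNIV p" and B: "\<And>x. exp (- p x) \<le> B"
    and dp: "AE x in lborel. GDERIV p x :> dp x" and dpm[measurable]: "dp \<in> borel_measurable borel"
    and V: "continuous_on UNIV V" and Vc: "\<And>x s. V (x + s *\<^sub>R V x) = V x"
    and mp: "\<And>s. distr lborel borel (\<lambda>x. x + s *\<^sub>R V x) = lborel"
    and F[measurable]: "F \<in> borel_measurable borel" and FM: "\<And>x. \<bar>F x\<bar> \<le> M"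
    and FR: "\<And>x. x \<notin> cball 0 R \<Longrightarrow> F x = 0"
  shows "DERIV (\<lambda>t. \<integral>x. F x * exp (- p (x + t *\<^sub>R V x)) \<partial>lborel) t
     :> (\<integral>y. F (y - t *\<^sub>R V y) * (- exp (- p y) * (V y \<bullet> dp y)) \<partial>lborel)"
proof -
  define \<psi> where "\<psi> s x = x + s *\<^sub>R V x" for s x
  define D where "D y = - exp (- p y) * (V y \<bullet> dp y)" for y
  have cont: "continuous_on UNIV p" by (rule convex_on_continuous[OF open_UNIV p])
  have cp: "continuous_on A (\<lambda>x. p (f x))" if "continuous_on A f" for A :: "'a set" and f
    by (rule continuous_on_compose2[OF cont that]) auto
  have Vs: "continuous_on A V" for A using V continuous_on_subset by blast
  have \<psi>c: "continuous_on A (\<psi> s)" for s A unfolding \<psi>_def by (intro continuous_intros Vs)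
  have \<psi>m[measurable]: "\<psi> s \<in> borel_measurable borel" for s
    by (rule borel_measurable_continuous_onI[OF \<psi>c])
  have Vm[measurable]: "V \<in> borel_measurable borel" by (rule borel_measurable_continuous_onI[OF V])
  have pm[measurable]: "p \<in> borel_measurable borel" by (rule borel_measurable_continuous_onI[OF cont])
  have Dm[measurable]: "D \<in> borel_measurable borel" unfolding D_def by measurable
  have M0: "M \<ge> 0" using FM[of 0] by simp
  have B0: "B \<ge> 0" using B[of 0] exp_ge_zero order_trans by blast
  have Fi: "integrable lborel (\<lambda>x. F x * exp (- p (\<psi> s x)))" for s
  proof (rule Bochner_Integration.integrable_bound)
    show "integrable lborel (\<lambda>x. indicator (cball (0::'a) R) x *\<^sub>R (M * B))"
      by (rule borel_integrable_compact) auto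
    show "AE x in lborel. norm (F x * exp (- p (\<psi> s x))) \<le> norm (indicator (cball 0 R) x *\<^sub>R (M * B))"
    proof (rule AE_I2)
      fix x
      have "\<bar>F x\<bar> * exp (- p (\<psi> s x)) \<le> M * B" using FM B M0 by (intro mult_mono) auto
      then show "norm (F x * exp (- p (\<psi> s x))) \<le> norm (indicator (cball 0 R) x *\<^sub>R (M * B))"
        using FR[of x] M0 B0 by (cases "x \<in> cball 0 R") (auto simp: abs_mult)
    qed
  qed measurable
  have shift: "(\<integral>y. F (y - t *\<^sub>R V y) * D y \<partial>lborel) = (\<integral>x. F x * D (\<psi> t x) \<partial>lborel)"
  proof -
    have "(\<integral>y. F (y - t *\<^sub>R V y) * D y \<partial>lborel) = (\<integral>y. F (y - t *\<^sub>R V y) * D y \<partial>distr lborel borel (\<psi> t))"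
      using mp[of t] unfolding \<psi>_def by simp
    also have "\<dots> = (\<integral>x. F (\<psi> t x - t *\<^sub>R V (\<psi> t x)) * D (\<psi> t x) \<partial>lborel)"
      by (rule integral_distr) measurable
    also have "(\<lambda>x. F (\<psi> t x - t *\<^sub>R V (\<psi> t x))) = F"
      unfolding \<psi>_def Vc by simp
    finally show ?thesis by (simp add: fun_eq_iff)
  qed
  have aeD: "AE x in lborel. GDERIV p (\<psi> t x) :> dp (\<psi> t x)"
  proof (rule AE_distrD[where M' = borel and f = "\<psi> t"])
    have "distr lborel borel (\<psi> t) = lborel" using mp[of t] by (simp add: \<psi>_def[abs_def])
    then show "AE x in distr lborel borel (\<psi> t). GDERIV p x :> dp x" by (simp only: dp)
  qed simp
  define W where "W x = indicator (cball 0 R) x *\<^sub>R (M * (B * (\<bar>p (\<psi> t x + V x) - p (\<psi> t x)\<bar> + \<bar>p (\<psi> t x - V x) - p (\<psi> t x)\<bar>)))" for x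
  have Wi: "integrable lborel W"
    unfolding W_def by (rule borel_integrable_compact) (auto intro!: continuous_intros cp \<psi>c Vs)
  \<comment> \<open>the restriction to \<open>|h| < 1\<close> makes the majorant valid along the whole sequence of steps\<close>
  have "((\<lambda>h. ((\<integral>x. F x * exp (- p (\<psi> (t + h) x)) \<partial>lborel) - (\<integral>x. F x * exp (- p (\<psi> t x)) \<partial>lborel)) / h)
      \<longlongrightarrow> (\<integral>x. F x * D (\<psi> t x) \<partial>lborel)) (at 0 within {-1<..<1})"
    unfolding tendsto_at_iff_sequentially comp_def
  proof (intro allI impI)
    fix X :: "nat \<Rightarrow> real" assume X: "\<forall>i. X i \<in> {-1<..<1} - {0}" and X0: "X \<longlonglongrightarrow> 0"
    have Xat: "filterlim X (at 0) sequentially" using X X0 by (auto simp: filterlim_at)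
    have eq: "((\<integral>x. F x * exp (- p (\<psi> (t + X i) x)) \<partial>lborel) - (\<integral>x. F x * exp (- p (\<psi> t x)) \<partial>lborel)) / X i
      = (\<integral>x. F x * ((exp (- p (\<psi> t x + X i *\<^sub>R V x)) - exp (- p (\<psi> t x))) / X i) \<partial>lborel)" for i
    proof -
      have "((\<integral>x. F x * exp (- p (\<psi> (t + X i) x)) \<partial>lborel) - (\<integral>x. F x * exp (- p (\<psi> t x)) \<partial>lborel)) / X i
        = (\<integral>x. (F x * exp (- p (\<psi> (t + X i) x)) - F x * exp (- p (\<psi> t x))) / X i \<partial>lborel)"
        using Fi by simp
      then show ?thesis by (simp add: \<psi>_def algebra_simps)
    qed
    show "(\<lambda>i. ((\<integral>x. F x * exp (- p (\<psi> (t + X i) x)) \<partial>lborel) - (\<integral>x. F x * exp (- p (\<psi> t x)) \<partial>lborel)) / X i)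
      \<longlonglongrightarrow> (\<integral>x. F x * D (\<psi> t x) \<partial>lborel)"
      unfolding eq
    proof (rule integral_dominated_convergence[OF _ _ Wi])
      show "AE x in lborel. (\<lambda>i. F x * ((exp (- p (\<psi> t x + X i *\<^sub>R V x)) - exp (- p (\<psi> t x))) / X i)) \<longlonglongrightarrow> F x * D (\<psi> t x)"
        using aeD
      proof eventually_elim
        case (elim x)
        have "V (\<psi> t x) = V x" unfolding \<psi>_def by (rule Vc)
        then have "V x \<bullet> (- exp (- p (\<psi> t x)) *\<^sub>R dp (\<psi> t x)) = D (\<psi> t x)" unfolding D_def by simp
        with filterlim_compose[OF gderiv_directional[OF gderiv_exp_minus[OF elim], of "V x"] Xat]
        show ?case by (intro tendsto_mult_left) simp
      qed
      show "AE x in lborel. norm (F x * ((exp (- p (\<psi> t x + X i *\<^sub>R V x)) - exp (- p (\<psi> t x))) / X i)) \<le> W x" for i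
      proof (rule AE_I2)
        fix x
        show "norm (F x * ((exp (- p (\<psi> t x + X i *\<^sub>R V x)) - exp (- p (\<psi> t x))) / X i)) \<le> W x"
        proof (cases "x \<in> cball 0 R")
          case False then show ?thesis using FR[of x] unfolding W_def by simp
        next
          case True
          define d where "d = \<bar>p (\<psi> t x + V x) - p (\<psi> t x)\<bar> + \<bar>p (\<psi> t x - V x) - p (\<psi> t x)\<bar>"
          have Xi: "\<bar>X i\<bar> \<le> 1" "X i \<noteq> 0" using X[rule_format, of i] by auto
          have "\<bar>exp (- p (\<psi> t x + X i *\<^sub>R V x)) - exp (- p (\<psi> t x))\<bar> \<le> B * \<bar>p (\<psi> t x + X i *\<^sub>R V x) - p (\<psi> t x)\<bar>"
            by (rule exp_minus_diff_le) (rule B)+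
          also have "\<dots> \<le> B * (\<bar>X i\<bar> * d)"
            unfolding d_def by (intro mult_left_mono convex_increment_bound[OF p] Xi B0)
          finally have "\<bar>exp (- p (\<psi> t x + X i *\<^sub>R V x)) - exp (- p (\<psi> t x))\<bar> / \<bar>X i\<bar> \<le> B * d"
            using Xi by (simp add: field_simps)
          then have "\<bar>F x\<bar> * (\<bar>exp (- p (\<psi> t x + X i *\<^sub>R V x)) - exp (- p (\<psi> t x))\<bar> / \<bar>X i\<bar>) \<le> M * (B * d)"
            using FM M0 by (intro mult_mono) auto
          then show ?thesis using True unfolding W_def d_def by (simp add: abs_mult)
        qed
      qed
    qed measurable
  qed
  moreover have "at 0 within {-1<..<1} = at (0::real)" by (rule at_within_open) auto
  ultimately show ?thesis
    unfolding DERIV_def shift[unfolded D_def] D_def \<psi>_def by simp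
qed

text \<open>
  The integral is the one-sided derivative at \<open>0\<close> of the overlap along the flow of \<open>V\<close>. For step sizes
  \<open>t k\<close> tending to \<open>0\<close>, truncate \<open>f\<close> to a ball so large that the overlaps change by much
  less than \<open>t k\<close>, and apply the mean value theorem to the truncated overlap. This gives intermediate parameters
  \<open>s k\<close> at which the derivatives \<open>\<Psi>\<close> are at most \<open>1 / (k + 1)\<close>; almost everywhere continuity and the decay of \<open>f\<close> let
  these derivatives converge to the integral in question.
\<close>

lemma first_variation_nonpos:
  fixes p :: "'a::euclidean_space \<Rightarrow> real" and dp V :: "'a \<Rightarrow> 'a" and f :: "'a \<Rightarrow> real"
  assumes p: "convex_on UNIV p" and B: "\<And>x. exp (- p x) \<le> B"
    and dp: "AE x in lborel. GDERIV p x :> dp x" and dpm[measurable]: "dp \<in> borel_measurable borel"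
    and L2: "(\<integral>\<^sup>+ x. ennreal ((norm (exp (- p x) *\<^sub>R dp x))\<^sup>2) \<partial>lborel) < \<infinity>"
    and V: "continuous_on UNIV V" and Vc: "\<And>x s. V (x + s *\<^sub>R V x) = V x"
    and Vb: "\<And>x. norm (V x) \<le> c * (1 + norm x)"
    and mp: "\<And>s. distr lborel borel (\<lambda>x. x + s *\<^sub>R V x) = lborel"
    and f[measurable]: "f \<in> borel_measurable borel" and f0: "\<And>x. 0 \<le> f x"
    and fA: "\<And>x. f x \<le> A * exp (- a * norm x)" and a: "a > 0"
    and fc: "AE x in lborel. isCont f x"
    and max: "\<And>s. s > 0 \<Longrightarrow> (\<integral>x. f x * exp (- p (x + s *\<^sub>R V x)) \<partial>lborel) \<le> (\<integral>x. f x * exp (- p x) \<partial>lborel)"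
  shows "(\<integral>x. f x * (- exp (- p x) * (V x \<bullet> dp x)) \<partial>lborel) \<le> 0"
proof -
  have cont: "continuous_on UNIV p" by (rule convex_on_continuous[OF open_UNIV p])
  have Vm[measurable]: "V \<in> borel_measurable borel" by (rule borel_measurable_continuous_onI[OF V])
  have pm[measurable]: "p \<in> borel_measurable borel" by (rule borel_measurable_continuous_onI[OF cont])
  define D where "D y = - exp (- p y) * (V y \<bullet> dp y)" for y
  have Dm[measurable]: "D \<in> borel_measurable borel" unfolding D_def by measurable
  have c0: "c \<ge> 0" using order_trans[OF norm_ge_zero Vb[of 0]] by simp
  have A0: "A \<ge> 0" using order_trans[OF f0[of 0] fA[of 0]] by simp
  have B0: "B \<ge> 0" using B[of 0] exp_ge_zero order_trans by blast
  have fi: "integrable lborel f"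
    by (rule Bochner_Integration.integrable_bound[OF integrable_mult_right[OF integrable_exp_norm[OF a], of A]])
       (use f0 fA A0 in \<open>auto intro!: AE_I2\<close>)
  have fA': "f x \<le> A" for x
  proof -
    have "A * exp (- a * norm x) \<le> A * 1" using A0 a by (intro mult_left_mono) auto
    then show ?thesis using fA[of x] by linarith
  qed
  define F where "F R x = (if x \<in> cball 0 (real R) then f x else 0)" for R :: nat and x
  have Fm[measurable]: "F R \<in> borel_measurable borel" for R
  proof -
    have [measurable]: "cball (0::'a) (real R) \<in> sets borel" by simp
    show ?thesis unfolding F_def by measurable
  qed
  have F0: "0 \<le> F R x" "F R x \<le> f x" for R x unfolding F_def using f0 by auto
  have FM: "\<bar>F R x\<bar> \<le> A" for R x using F0[of R x] fA'[of x] by linarith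
  define \<Phi> where "\<Phi> h t = (\<integral>x. h x * exp (- p (x + t *\<^sub>R V x)) \<partial>lborel)" for h t
  define \<Psi> where "\<Psi> R t = (\<integral>y. F R (y - t *\<^sub>R V y) * D y \<partial>lborel)" for R t
  have der: "DERIV (\<Phi> (F R)) t :> \<Psi> R t" for R t
    unfolding \<Phi>_def \<Psi>_def D_def
    by (rule compact_overlap_has_derivative[OF p B dp dpm V Vc mp Fm FM, where R = "real R"]) (simp add: F_def)
  have lim: "(\<lambda>R. \<Phi> (F R) t) \<longlonglongrightarrow> \<Phi> f t" for t
    unfolding \<Phi>_def
  proof (rule integral_dominated_convergence[where w = "\<lambda>x. B * f x"])
    show "integrable lborel (\<lambda>x. B * f x)" using fi by simp
    show "AE x in lborel. norm (F R x * exp (- p (x + t *\<^sub>R V x))) \<le> B * f x" for R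
    proof (rule AE_I2)
      fix x
      have "F R x * exp (- p (x + t *\<^sub>R V x)) \<le> f x * B" using F0 B f0 by (intro mult_mono) auto
      then show "norm (F R x * exp (- p (x + t *\<^sub>R V x))) \<le> B * f x"
        using F0(1)[of R x] by (simp add: abs_mult mult.commute)
    qed
    show "AE x in lborel. (\<lambda>R. F R x * exp (- p (x + t *\<^sub>R V x))) \<longlonglongrightarrow> f x * exp (- p (x + t *\<^sub>R V x))"
    proof (rule AE_I2, rule tendsto_mult_right, rule tendsto_eventually)
      fix x :: 'a
      show "\<forall>\<^sub>F R in sequentially. F R x = f x"
        using eventually_ge_at_top[of "nat \<lceil>norm x\<rceil>"]
        by eventually_elim (auto simp: F_def)
    qed
  qed measurable
  \<comment> \<open>for steps up to \<open>\<tau>\<close> the flow moves a point \<open>y\<close> by at most \<open>(1 + |y|) / 2\<close>, so half of the decay survives\<close>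
  define \<tau> where "\<tau> = 1 / (2 * c + 2)"
  have \<tau>: "\<tau> > 0" "c * \<tau> \<le> 1/2" unfolding \<tau>_def using c0 by (auto simp: field_simps)
  define t :: "nat \<Rightarrow> real" where "t k = \<tau> / (real k + 1)" for k
  have t: "0 < t k" "t k \<le> \<tau>" for k unfolding t_def using \<tau>(1) by (auto simp: field_simps)
  have "\<exists>R s. k \<le> R \<and> 0 < s \<and> s < t k \<and> \<Psi> R s \<le> 1 / (real k + 1)" for k :: nat
  proof -
    define X where "X = t k * (1 / (real k + 1))"
    define e where "e = X / 2"
    have e: "e > 0" unfolding e_def X_def using t(1)[of k] by simp
    have "\<forall>\<^sub>F R in sequentially. \<bar>\<Phi> (F R) (t k) - \<Phi> f (t k)\<bar> < e \<and> \<bar>\<Phi> (F R) 0 - \<Phi> f 0\<bar> < e \<and> k \<le> R"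
      using tendstoD[OF lim e, of "t k"] tendstoD[OF lim e, of 0] eventually_ge_at_top[of k]
      by eventually_elim (simp add: dist_real_def)
    then obtain R where R: "\<bar>\<Phi> (F R) (t k) - \<Phi> f (t k)\<bar> < e" "\<bar>\<Phi> (F R) 0 - \<Phi> f 0\<bar> < e" "k \<le> R"
      by (auto simp: eventually_sequentially)
    obtain s where s: "0 < s" "s < t k" "\<Phi> (F R) (t k) - \<Phi> (F R) 0 = (t k - 0) * \<Psi> R s"
      using MVT2[of 0 "t k" "\<Phi> (F R)" "\<Psi> R"] t(1)[of k] der by blast
    have "\<Phi> f (t k) \<le> \<Phi> f 0" using max[OF t(1)[of k]] unfolding \<Phi>_def by simp
    moreover have "\<Phi> (F R) (t k) - \<Phi> (F R) 0 = t k * \<Psi> R s" using s(3) by simp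
    ultimately have "t k * \<Psi> R s \<le> 2 * e" using R(1,2) by linarith
    also have "2 * e = t k * (1 / (real k + 1))" unfolding X_def[symmetric] e_def by simp
    finally have "\<Psi> R s \<le> 1 / (real k + 1)" using t(1)[of k] by (simp only: mult_le_cancel_left_pos)
    then show ?thesis using R(3) s by blast
  qed
  then obtain R s where R: "\<And>k. k \<le> R k" and s: "\<And>k. 0 < s k" "\<And>k. s k < t k" and \<Psi>: "\<And>k. \<Psi> (R k) (s k) \<le> 1 / (real k + 1)"
    by metis
  have s_lim: "s \<longlonglongrightarrow> 0"
  proof (rule tendsto_sandwich[of "\<lambda>_. 0" _ _ t])
    have "(\<lambda>k. \<tau> * (1 / (real k + 1))) \<longlonglongrightarrow> \<tau> * 0"
      by (intro tendsto_mult_left LIMSEQ_one_over_Suc)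
    then show "t \<longlonglongrightarrow> 0" unfolding t_def by simp
  qed (use s in \<open>auto intro!: always_eventually less_imp_le\<close>)
  define b where "b = a / 2"
  have b: "b > 0" unfolding b_def using a by simp
  define q where "q y = exp (- p y) *\<^sub>R dp y" for y
  have qm: "q \<in> borel_measurable borel" unfolding q_def by measurable
  define W where "W y = (A * exp b * c) * (exp (- b * norm y) * (1 + norm y) * norm (q y))" for y
  have Wi: "integrable lborel W"
    unfolding W_def by (intro integrable_mult_right weighted_L2_integrable b qm L2[folded q_def])
  have "(\<lambda>k. \<Psi> (R k) (s k)) \<longlonglongrightarrow> (\<integral>y. f y * D y \<partial>lborel)"
    unfolding \<Psi>_def
  proof (rule integral_dominated_convergence[OF _ _ Wi])
    show "AE y in lborel. (\<lambda>k. F (R k) (y - s k *\<^sub>R V y) * D y) \<longlonglongrightarrow> f y * D y"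
      using fc
    proof eventually_elim
      case (elim y)
      have l: "(\<lambda>k. y - s k *\<^sub>R V y) \<longlonglongrightarrow> y - 0 *\<^sub>R V y" by (intro tendsto_intros s_lim)
      then have "(\<lambda>k. f (y - s k *\<^sub>R V y)) \<longlonglongrightarrow> f y"
        using isCont_tendsto_compose[OF elim] by simp
      moreover have "\<forall>\<^sub>F k in sequentially. f (y - s k *\<^sub>R V y) = F (R k) (y - s k *\<^sub>R V y)"
      proof -
        have "\<forall>\<^sub>F k in sequentially. norm (y - s k *\<^sub>R V y) < norm y + 1"
          using order_tendstoD(2)[OF tendsto_norm[OF l], of "norm y + 1"] by simp
        then show ?thesis using eventually_ge_at_top[of "nat \<lceil>norm y + 1\<rceil>"]
        proof eventually_elim
          case (elim k)
          then have "norm y + 1 \<le> real (R k)" using R[of k] by linarith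
          then show ?case using elim unfolding F_def by simp
        qed
      qed
      ultimately have "(\<lambda>k. F (R k) (y - s k *\<^sub>R V y)) \<longlonglongrightarrow> f y"
        by (rule Lim_transform_eventually)
      then show ?case by (rule tendsto_mult_right)
    qed
    show "AE y in lborel. norm (F (R k) (y - s k *\<^sub>R V y) * D y) \<le> W y" for k
    proof (rule AE_I2)
      fix y
      have n1: "norm y \<le> norm (y - s k *\<^sub>R V y) + norm (s k *\<^sub>R V y)"
        using norm_triangle_ineq[of "y - s k *\<^sub>R V y" "s k *\<^sub>R V y"] by simp
      have "norm (s k *\<^sub>R V y) \<le> \<tau> * (c * (1 + norm y))"
        unfolding norm_scaleR using s[of k] t(2)[of k] Vb[of y] \<tau>(1) by (intro mult_mono) auto
      also have "\<dots> \<le> (1/2) * (1 + norm y)"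
        using mult_right_mono[OF \<tau>(2), of "1 + norm y"] by (simp add: mult_ac)
      finally have n2: "norm (s k *\<^sub>R V y) \<le> (1/2) * (1 + norm y)" .
      have "u - 1 \<le> 2 * n" if "u \<le> n + r" "r \<le> (1/2) * (1 + u)" for u n r :: real
        using that by (simp add: field_simps)
      from this[OF n1 n2] have "norm y - 1 \<le> 2 * norm (y - s k *\<^sub>R V y)" .
      then have "b * (norm y - 1) \<le> b * (2 * norm (y - s k *\<^sub>R V y))"
        using b by (intro mult_left_mono) auto
      then have le: "- a * norm (y - s k *\<^sub>R V y) \<le> b + - b * norm y"
        unfolding b_def by (simp add: algebra_simps)
      have "F (R k) (y - s k *\<^sub>R V y) \<le> A * exp (- a * norm (y - s k *\<^sub>R V y))"
        using F0 fA order_trans by blast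
      also have "\<dots> \<le> A * exp (b + - b * norm y)" using le A0 by (intro mult_left_mono) auto
      also have "\<dots> = A * exp b * exp (- b * norm y)" by (simp only: exp_add mult.assoc)
      finally have Fle: "\<bar>F (R k) (y - s k *\<^sub>R V y)\<bar> \<le> A * exp b * exp (- b * norm y)"
        using F0(1) by simp
      have "\<bar>D y\<bar> = exp (- p y) * \<bar>V y \<bullet> dp y\<bar>" unfolding D_def by (simp add: abs_mult)
      also have "\<dots> \<le> exp (- p y) * (norm (V y) * norm (dp y))"
        by (intro mult_left_mono Cauchy_Schwarz_ineq2) auto
      also have "\<dots> = norm (V y) * norm (q y)" unfolding q_def by simp
      also have "\<dots> \<le> c * (1 + norm y) * norm (q y)" by (intro mult_right_mono Vb) auto
      finally have "\<bar>F (R k) (y - s k *\<^sub>R V y)\<bar> * \<bar>D y\<bar> \<le> (A * exp b * exp (- b * norm y)) * (c * (1 + norm y) * norm (q y))"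
        using Fle A0 by (intro mult_mono) auto
      then show "norm (F (R k) (y - s k *\<^sub>R V y) * D y) \<le> W y"
        unfolding W_def by (simp add: abs_mult mult_ac)
    qed
  qed measurable
  then have "(\<integral>y. f y * D y \<partial>lborel) \<le> 0"
    by (rule LIMSEQ_le[OF _ LIMSEQ_one_over_Suc]) (use \<Psi> in auto)
  then show ?thesis unfolding D_def .
qed

text \<open>
  Both \<open>V\<close> and \<open>- V\<close> are admissible directions.
\<close>

lemma first_variation_eq_0:
  fixes p :: "'a::euclidean_space \<Rightarrow> real" and dp V :: "'a \<Rightarrow> 'a" and f :: "'a \<Rightarrow> real"
  assumes p: "convex_on UNIV p" and B: "\<And>x. exp (- p x) \<le> B"
    and dp: "AE x in lborel. GDERIV p x :> dp x" and dpm: "dp \<in> borel_measurable borel"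
    and L2: "(\<integral>\<^sup>+ x. ennreal ((norm (exp (- p x) *\<^sub>R dp x))\<^sup>2) \<partial>lborel) < \<infinity>"
    and V: "continuous_on UNIV V" and Vc: "\<And>x s. V (x + s *\<^sub>R V x) = V x"
    and Vb: "\<And>x. norm (V x) \<le> c * (1 + norm x)"
    and mp: "\<And>s. distr lborel borel (\<lambda>x. x + s *\<^sub>R V x) = lborel"
    and f: "f \<in> borel_measurable borel" and f0: "\<And>x. 0 \<le> f x"
    and fA: "\<And>x. f x \<le> A * exp (- a * norm x)" and a: "a > 0"
    and fc: "AE x in lborel. isCont f x"
    and max: "\<And>s. (\<integral>x. f x * exp (- p (x + s *\<^sub>R V x)) \<partial>lborel) \<le> (\<integral>x. f x * exp (- p x) \<partial>lborel)"
  shows "(\<integral>x. f x * exp (- p x) * (V x \<bullet> dp x) \<partial>lborel) = 0"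
proof -
  have "(\<integral>x. f x * (- exp (- p x) * (V x \<bullet> dp x)) \<partial>lborel) \<le> 0"
    by (rule first_variation_nonpos[OF p B dp dpm L2 V Vc Vb mp f f0 fA a fc max])
  moreover have "(\<integral>x. f x * (- exp (- p x) * (- V x \<bullet> dp x)) \<partial>lborel) \<le> 0"
  proof (rule first_variation_nonpos[OF p B dp dpm L2 _ _ _ _ f f0 fA a fc])
    show "continuous_on UNIV (\<lambda>x. - V x)" by (intro continuous_intros V)
    show "- V (x + s *\<^sub>R - V x) = - V x" for x s using Vc[of x "- s"] by simp
    show "norm (- V x) \<le> c * (1 + norm x)" for x using Vb by simp
    show "distr lborel borel (\<lambda>x. x + s *\<^sub>R - V x) = lborel" for s using mp[of "- s"] by simp
    show "(\<integral>x. f x * exp (- p (x + s *\<^sub>R - V x)) \<partial>lborel) \<le> (\<integral>x. f x * exp (- p x) \<partial>lborel)" for s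
      using max[of "- s"] by simp
  qed
  ultimately show ?thesis by (simp add: mult.assoc)
qed

lemma tensor_component: "tensor x y $ i $ j = x $ i * y $ j"
  unfolding tensor_def matrix_def by (simp add: inner_axis' mult.commute)

lemma tensor_measurable:
  fixes F :: "'a::euclidean_space \<Rightarrow> real^'n"
  assumes [measurable]: "F \<in> borel_measurable borel" "G \<in> borel_measurable borel"
  shows "(\<lambda>x. tensor (F x) (G x)) \<in> borel_measurable borel"
proof (subst borel_measurable_euclidean_space, rule ballI)
  fix b :: "real^'n^'n" assume "b \<in> Basis"
  then obtain i j where b: "b = axis i (axis j 1)" by (auto simp: Basis_vec_def)
  show "(\<lambda>x. tensor (F x) (G x) \<bullet> b) \<in> borel_measurable borel"
    unfolding b inner_axis tensor_component by (simp add: cart_eq_inner_axis)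
qed

lemma norm_tensor_le:
  fixes x y :: "real^'n"
  shows "norm (tensor x y) \<le> (real CARD('n))\<^sup>2 * (norm x * norm y)"
proof -
  have "\<bar>tensor x y $ i $ j\<bar> \<le> norm x * norm y" for i j
    unfolding tensor_component abs_mult by (intro mult_mono component_le_norm_cart) auto
  from norm_matrix_vector_le(2)[OF this] show ?thesis by (simp add: power2_eq_square mult_ac)
qed

section \<open>Maximal intersection position\<close>

lemma overlap_eq_affine:
  fixes f f' g :: "real^'n \<Rightarrow> real"
  assumes f'[measurable]: "f' \<in> borel_measurable borel" and ff': "AE x in lebesgue. f x = f' x"
    and g: "continuous_on UNIV g"
  shows "overlap f g T z = (\<integral>x. f' x * g (matrix_inv T *v x + - (matrix_inv T *v z)) \<partial>lborel)"
proof -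
  have "continuous_on UNIV (\<lambda>x. g (matrix_inv T *v x + - (matrix_inv T *v z)))"
  proof (rule continuous_on_compose2[OF g])
    show "continuous_on UNIV (\<lambda>x. matrix_inv T *v x + - (matrix_inv T *v z))"
      by (intro continuous_on_add continuous_on_const linear_continuous_on) (simp add: linear_linear)
  qed simp
  then have [measurable]: "(\<lambda>x. g (matrix_inv T *v x + - (matrix_inv T *v z))) \<in> borel_measurable borel"
    by (rule borel_measurable_continuous_onI)
  show ?thesis
    unfolding overlap_def
    by (rule lebesgue_integral_via_borel(2), measurable)
       (use ff' in eventually_elim, simp add: matrix_vector_mult_diff_distrib)
qed

text \<open>
  The substitution \<open>T = S\<inverse>\<close>, \<open>z = - S\<inverse> c\<close> inverts the one of the preceding lemma; both together identify
  the positions \<open>(T, z)\<close> with the affine maps of determinant one.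
\<close>

lemma overlap_of_affine:
  fixes f f' g :: "real^'n \<Rightarrow> real"
  assumes "f' \<in> borel_measurable borel" "AE x in lebesgue. f x = f' x" "continuous_on UNIV g"
    and S: "det S = 1"
  shows "overlap f g (matrix_inv S) (- (matrix_inv S *v c)) = (\<integral>x. f' x * g (S *v x + c) \<partial>lborel)"
    and "ereal (\<integral>x. f' x * g (S *v x + c) \<partial>lborel) \<le> max_overlap f g"
proof -
  have "- (S *v - (matrix_inv S *v c)) = c"
    using matrix_inv_det_1(1)[OF S] by (simp add: linear_neg[OF matrix_vector_mul_linear] matrix_vector_mul_assoc)
  then show eq: "overlap f g (matrix_inv S) (- (matrix_inv S *v c)) = (\<integral>x. f' x * g (S *v x + c) \<partial>lborel)"
    unfolding overlap_eq_affine[OF assms(1-3)] matrix_inv_det_1(4)[OF S] by simp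
  show "ereal (\<integral>x. f' x * g (S *v x + c) \<partial>lborel) \<le> max_overlap f g"
    unfolding max_overlap_def
    by (rule SUP_upper2[of "(matrix_inv S, - (matrix_inv S *v c))"]) (auto simp: SL_def matrix_inv_det_1 S eq)
qed

text \<open>
  The norms of both integrands are bounded by a multiple of the weight \<open>exp (- a |x|) (1 + |x|)\<close> times \<open>|\<nabla> exp (- p)|\<close>.
\<close>

lemma gradient_moments_integrable:
  fixes p f :: "real^'n \<Rightarrow> real" and dp :: "real^'n \<Rightarrow> real^'n"
  assumes pm[measurable]: "p \<in> borel_measurable borel" and dpm[measurable]: "dp \<in> borel_measurable borel"
    and L2: "(\<integral>\<^sup>+ x. ennreal ((norm (exp (- p x) *\<^sub>R dp x))\<^sup>2) \<partial>lborel) < \<infinity>"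
    and f[measurable]: "f \<in> borel_measurable borel" and f0: "\<And>x. 0 \<le> f x"
    and fA: "\<And>x. f x \<le> A * exp (- a * norm x)" and a: "a > 0"
  shows "integrable lborel (\<lambda>x. (f x * exp (- p x)) *\<^sub>R tensor (dp x) x)"
    and "integrable lborel (\<lambda>x. (f x * exp (- p x)) *\<^sub>R dp x)"
proof -
  define q where "q x = exp (- p x) *\<^sub>R dp x" for x
  have qm: "q \<in> borel_measurable borel" unfolding q_def by measurable
  define W where "W x = A * (exp (- a * norm x) * (1 + norm x) * norm (q x))" for x
  have Wi: "integrable lborel W"
    unfolding W_def by (intro integrable_mult_right weighted_L2_integrable a qm L2[folded q_def])
  have Wb: "f x * exp (- p x) * norm (dp x) * (1 + norm x) \<le> W x" for x
  proof -
    have "f x * (norm (q x) * (1 + norm x)) \<le> (A * exp (- a * norm x)) * (norm (q x) * (1 + norm x))"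
      by (intro mult_right_mono fA) auto
    then show ?thesis unfolding W_def q_def by (simp add: mult_ac)
  qed
  have Wn: "f x * exp (- p x) * norm (dp x) * norm x \<le> W x" "f x * exp (- p x) * norm (dp x) \<le> W x" for x
  proof -
    have "0 \<le> f x * exp (- p x) * norm (dp x)" "0 \<le> f x * exp (- p x) * norm (dp x) * norm x"
      using f0 by simp_all
    then show "f x * exp (- p x) * norm (dp x) * norm x \<le> W x" "f x * exp (- p x) * norm (dp x) \<le> W x"
      using Wb[of x] unfolding distrib_left mult_1_right by linarith+
  qed
  have tm[measurable]: "(\<lambda>x. tensor (dp x) x) \<in> borel_measurable borel" by (intro tensor_measurable) measurable
  show "integrable lborel (\<lambda>x. (f x * exp (- p x)) *\<^sub>R tensor (dp x) x)"
  proof (rule Bochner_Integration.integrable_bound[OF integrable_mult_right[OF Wi, of "(real CARD('n))\<^sup>2"]])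
    show "AE x in lborel. norm ((f x * exp (- p x)) *\<^sub>R tensor (dp x) x) \<le> norm ((real CARD('n))\<^sup>2 * W x)"
    proof (rule AE_I2)
      fix x
      have "norm ((f x * exp (- p x)) *\<^sub>R tensor (dp x) x) = (f x * exp (- p x)) * norm (tensor (dp x) x)"
        using f0 by simp
      also have "\<dots> \<le> (f x * exp (- p x)) * ((real CARD('n))\<^sup>2 * (norm (dp x) * norm x))"
        using f0 by (intro mult_left_mono norm_tensor_le) auto
      also have "\<dots> = (real CARD('n))\<^sup>2 * (f x * exp (- p x) * norm (dp x) * norm x)" by simp
      also have "\<dots> \<le> (real CARD('n))\<^sup>2 * W x" by (intro mult_left_mono Wn) auto
      finally show "norm ((f x * exp (- p x)) *\<^sub>R tensor (dp x) x) \<le> norm ((real CARD('n))\<^sup>2 * W x)"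
        by simp
    qed
  qed measurable
  show "integrable lborel (\<lambda>x. (f x * exp (- p x)) *\<^sub>R dp x)"
  proof (rule Bochner_Integration.integrable_bound[OF Wi])
    show "AE x in lborel. norm ((f x * exp (- p x)) *\<^sub>R dp x) \<le> norm (W x)"
      using order_trans[OF Wn(2) abs_ge_self] f0 by (intro AE_I2) simp
  qed measurable
qed

text \<open>
  Stationarity along the flows of \<open>e\<^sub>i\<close>, \<open>x\<^sub>j e\<^sub>i\<close> and \<open>(x\<^sub>i - x\<^sub>j) (e\<^sub>i + e\<^sub>j)\<close>. The last one is
  the transvection flow of \<open>x\<^sub>i e\<^sub>j\<close> conjugated by \<open>I + E\<^sub>i\<^sub>j\<close>. It compares two diagonal entries and, unlike the
  diagonal flow \<open>x\<^sub>i e\<^sub>i - x\<^sub>j e\<^sub>j\<close>, still moves points along straight lines.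
\<close>

lemma affine_stationarity:
  fixes p f :: "real^'n \<Rightarrow> real" and dp :: "real^'n \<Rightarrow> real^'n"
  assumes p: "convex_on UNIV p" and B: "\<And>x. exp (- p x) \<le> B"
    and dp: "AE x in lborel. GDERIV p x :> dp x" and dpm: "dp \<in> borel_measurable borel"
    and L2: "(\<integral>\<^sup>+ x. ennreal ((norm (exp (- p x) *\<^sub>R dp x))\<^sup>2) \<partial>lborel) < \<infinity>"
    and f: "f \<in> borel_measurable borel" and f0: "\<And>x. 0 \<le> f x"
    and fA: "\<And>x. f x \<le> A * exp (- a * norm x)" and a: "a > 0"
    and fc: "AE x in lborel. isCont f x"
    and max: "\<And>S c. det S = 1 \<Longrightarrow>
      (\<integral>x. f x * exp (- p (S *v x + c)) \<partial>lborel) \<le> (\<integral>x. f x * exp (- p x) \<partial>lborel)"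
  defines "M \<equiv> \<integral>x. (f x * exp (- p x)) *\<^sub>R tensor (dp x) x \<partial>lborel"
  shows "(\<integral>x. (f x * exp (- p x)) *\<^sub>R dp x \<partial>lborel) = 0"
    and "i \<noteq> j \<Longrightarrow> M $ i $ j = 0"
    and "M $ i $ i = M $ j $ j"
proof -
  have pm: "p \<in> borel_measurable borel"
    by (rule borel_measurable_continuous_onI[OF convex_on_continuous[OF open_UNIV p]])
  note int = gradient_moments_integrable[OF pm dpm L2 f f0 fA a]
  have var: "(\<integral>x. f x * exp (- p x) * (V x \<bullet> dp x) \<partial>lborel) = 0"
    if "continuous_on UNIV V" "\<And>x s. V (x + s *\<^sub>R V x) = V x" "\<And>x. norm (V x) \<le> 4 * (1 + norm x)"
      "\<And>s. distr lborel borel (\<lambda>x. x + s *\<^sub>R V x) = lborel"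
      and aff: "\<And>s. \<exists>S c. det S = 1 \<and> (\<forall>x. x + s *\<^sub>R V x = S *v x + c)" for V
  proof (rule first_variation_eq_0[OF p B dp dpm L2 that(1-4) f f0 fA a fc])
    fix s
    obtain S c where "det S = 1" "\<And>x. x + s *\<^sub>R V x = S *v x + c" using aff[of s] by blast
    then show "(\<integral>x. f x * exp (- p (x + s *\<^sub>R V x)) \<partial>lborel) \<le> (\<integral>x. f x * exp (- p x) \<partial>lborel)"
      using max by simp
  qed
  have bl: "bounded_linear (\<lambda>X::real^'n^'n. X $ i $ j)" for i j
    by (rule bounded_linear_compose[OF bounded_linear_vec_nth bounded_linear_vec_nth])
  define J where "J i j = (\<integral>x. f x * exp (- p x) * (dp x $ i * x $ j) \<partial>lborel)" for i j
  have entry: "M $ i $ j = J i j" for i j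
    unfolding M_def using integral_bounded_linear[OF bl int(1)] by (simp add: J_def tensor_component)
  have Jij: "integrable lborel (\<lambda>x. f x * exp (- p x) * (dp x $ i * x $ j))" for i j
    using integrable_bounded_linear[OF bl int(1)] by (simp add: tensor_component)
  have nax: "norm (axis i (1::real)) = 1" for i :: 'n by simp
  have transl: "(\<integral>x. f x * exp (- p x) * dp x $ i \<partial>lborel) = 0" for i
  proof -
    have "(\<integral>x. f x * exp (- p x) * (axis i 1 \<bullet> dp x) \<partial>lborel) = 0"
    proof (rule var)
      show "distr lborel borel (\<lambda>x. x + s *\<^sub>R axis i (1::real)) = lborel" for s
        using shear_preserves_lborel[of "axis i (1::real)" 0 s] by simp
      show "\<exists>S c. det S = 1 \<and> (\<forall>x. x + s *\<^sub>R axis i (1::real) = S *v x + c)" for s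
        by (intro exI[of _ "mat 1"] exI[of _ "s *\<^sub>R axis i 1"]) simp
    qed (auto simp: nax)
    then show ?thesis by (simp add: inner_axis')
  qed
  have offdiag: "J i j = 0" if ij: "i \<noteq> j" for i j
  proof -
    have "(\<integral>x. f x * exp (- p x) * ((x $ j *\<^sub>R axis i 1) \<bullet> dp x) \<partial>lborel) = 0"
    proof (rule var)
      have T: "x + s *\<^sub>R (x $ j *\<^sub>R axis i 1) = transvection i j s *v x" for s and x :: "real^'n"
        by (simp add: transvection_mult)
      show "distr lborel borel (\<lambda>x. x + s *\<^sub>R (x $ j *\<^sub>R axis i 1)) = lborel" for s
        unfolding T by (rule distr_transvection[OF ij])
      show "\<exists>S c. det S = 1 \<and> (\<forall>x. x + s *\<^sub>R (x $ j *\<^sub>R axis i 1) = S *v x + c)" for s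
        unfolding T using det_transvection[OF ij] by (intro exI[of _ "transvection i j s"] exI[of _ 0]) simp
      show "norm (x $ j *\<^sub>R axis i (1::real)) \<le> 4 * (1 + norm x)" for x :: "real^'n"
        using component_le_norm_cart[of x j] by (simp add: nax)
      show "(x + s *\<^sub>R (x $ j *\<^sub>R axis i 1)) $ j *\<^sub>R axis i 1 = x $ j *\<^sub>R axis i (1::real)" for x :: "real^'n" and s :: real
        using ij by (simp add: axis_def)
    qed (intro continuous_intros)
    then show ?thesis unfolding J_def by (simp add: inner_axis' mult_ac)
  qed
  have diag: "J i i = J j j" for i j
  proof (cases "i = j")
    case ij: False
    have "(\<integral>x. f x * exp (- p x) * (((x $ i - x $ j) *\<^sub>R (axis i 1 + axis j 1)) \<bullet> dp x) \<partial>lborel) = 0"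
    proof (rule var)
      have T: "x + s *\<^sub>R ((x $ i - x $ j) *\<^sub>R (axis i 1 + axis j 1))
          = transvection i j 1 *v (transvection j i s *v (transvection i j (-1) *v x))" for s and x :: "real^'n"
        unfolding transvection_mult using ij
        by (simp add: axis_def vec_eq_iff algebra_simps)
      show "\<exists>S c. det S = 1 \<and> (\<forall>x. x + s *\<^sub>R ((x $ i - x $ j) *\<^sub>R (axis i 1 + axis j 1)) = S *v x + c)" for s
        unfolding T using ij
        by (intro exI[of _ "transvection i j 1 ** transvection j i s ** transvection i j (-1)"] exI[of _ 0])
           (simp add: det_mul det_transvection matrix_vector_mul_assoc matrix_mul_assoc)
      have tm: "(\<lambda>x. transvection k l t *v x) \<in> borel_measurable borel" for k l :: 'n and t
        by (intro borel_measurable_continuous_onI linear_continuous_on) (simp add: linear_linear)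
      show "distr lborel borel (\<lambda>x. x + s *\<^sub>R ((x $ i - x $ j) *\<^sub>R (axis i 1 + axis j 1))) = lborel" for s
      proof -
        have "distr lborel borel (\<lambda>x. transvection i j 1 *v (transvection j i s *v (transvection i j (-1) *v x)))
          = distr (distr (distr lborel borel (\<lambda>x. transvection i j (-1) *v x)) borel (\<lambda>x. transvection j i s *v x))
              borel (\<lambda>x. transvection i j 1 *v x)"
          using tm by (subst distr_distr distr_distr; simp add: comp_def)+
        also have "\<dots> = lborel"
          using ij distr_transvection[of i j] distr_transvection[of j i] by simp
        finally show ?thesis unfolding T .
      qed
      show "norm ((x $ i - x $ j) *\<^sub>R (axis i 1 + axis j (1::real))) \<le> 4 * (1 + norm x)" for x :: "real^'n"
      proof -
        have "\<bar>x $ i - x $ j\<bar> \<le> 2 * norm x"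
          using component_le_norm_cart[of x i] component_le_norm_cart[of x j] by linarith
        moreover have "norm (axis i 1 + axis j (1::real)) \<le> 2"
          using norm_triangle_ineq[of "axis i (1::real)" "axis j 1"] by (simp add: nax)
        ultimately have "\<bar>x $ i - x $ j\<bar> * norm (axis i 1 + axis j (1::real)) \<le> (2 * norm x) * 2"
          by (intro mult_mono) auto
        then show ?thesis by simp
      qed
      show "((x + s *\<^sub>R ((x $ i - x $ j) *\<^sub>R (axis i 1 + axis j 1))) $ i - (x + s *\<^sub>R ((x $ i - x $ j) *\<^sub>R (axis i 1 + axis j 1))) $ j) *\<^sub>R (axis i 1 + axis j 1)
        = (x $ i - x $ j) *\<^sub>R (axis i 1 + axis j (1::real))" for x :: "real^'n" and s :: real
        using ij by (simp add: axis_def)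
    qed (intro continuous_intros)
    also have "(\<lambda>x. f x * exp (- p x) * (((x $ i - x $ j) *\<^sub>R (axis i 1 + axis j 1)) \<bullet> dp x))
      = (\<lambda>x. f x * exp (- p x) * (dp x $ i * x $ i) + f x * exp (- p x) * (dp x $ j * x $ i)
           - f x * exp (- p x) * (dp x $ i * x $ j) - f x * exp (- p x) * (dp x $ j * x $ j))"
      by (simp add: fun_eq_iff inner_add_left inner_axis' algebra_simps)
    finally have "J i i + J j i - J i j - J j j = 0" unfolding J_def using Jij by simp
    then show ?thesis using offdiag[OF ij] offdiag[of j i] ij by simp
  qed simp
  show "i \<noteq> j \<Longrightarrow> M $ i $ j = 0" unfolding entry by (rule offdiag)
  show "M $ i $ i = M $ j $ j" unfolding entry by (rule diag)
  have "(\<integral>x. (f x * exp (- p x)) *\<^sub>R dp x \<partial>lborel) $ i = 0" for i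
    using integral_bounded_linear[OF bounded_linear_vec_nth[of i] int(2)] transl[of i] by simp
  then show "(\<integral>x. (f x * exp (- p x)) *\<^sub>R dp x \<partial>lborel) = 0" by (simp add: vec_eq_iff)
qed

theorem theorem2:
  fixes f g :: "real^'n \<Rightarrow> real" and \<phi> :: "real^'n \<Rightarrow> ereal"
  assumes "log_concave f" and "integrable lebesgue f"
    and "convex_ereal \<phi>" and "g = (\<lambda>x. exp_neg (\<phi> x))" and "integrable lebesgue g"
    and "supp g = UNIV"
    and "(\<integral>\<^sup>+ x. ennreal ((norm (gradient g x))\<^sup>2) \<partial>lebesgue) < \<infinity>"
  shows "(\<exists>T\<^sub>0 \<in> SL. \<exists>z\<^sub>0. ereal (overlap f g T\<^sub>0 z\<^sub>0) = max_overlap f g) \<and>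
    (max_intersection_position f g \<longrightarrow>
      integrable lebesgue (\<lambda>x. (f x * g x) *\<^sub>R tensor (gradient_ereal \<phi> x) x) \<and>
      set_integrable lebesgue (supp f) (\<lambda>x. (f x * g x) *\<^sub>R gradient_ereal \<phi> x) \<and>
      set_integrable lebesgue (supp f) (\<lambda>x. (gradient_ereal \<phi> x \<bullet> x) * f x * g x) \<and>
      C_const f g \<phi> *\<^sub>R mat 1 = (LINT x|lebesgue. (f x * g x) *\<^sub>R tensor (gradient_ereal \<phi> x) x) \<and>
      0 = (LINT x:supp f|lebesgue. (f x * g x) *\<^sub>R gradient_ereal \<phi> x))"
proof -
  define p where "p x = real_of_ereal (\<phi> x)" for x
  have full: "supp (\<lambda>x. exp_neg (\<phi> x)) = UNIV" using assms(4,6) by simp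
  have fin: "\<phi> x = ereal (p x)" for x
    unfolding p_def by (rule log_concave_full_support(1)[OF assms(3) full])
  have p: "convex_on UNIV p"
    unfolding p_def[abs_def] by (rule log_concave_full_support(2)[OF assms(3) full])
  have g: "g = (\<lambda>x. exp (- p x))" unfolding assms(4) exp_neg_def fin by simp
  have pcont: "continuous_on UNIV p" by (rule convex_on_continuous[OF open_UNIV p])
  have pm[measurable]: "p \<in> borel_measurable borel" by (rule borel_measurable_continuous_onI[OF pcont])
  have gcont: "continuous_on UNIV g" unfolding g by (intro continuous_intros pcont)
  have lcg: "log_concave g" using assms(3,4) by (auto simp: log_concave_def)
  obtain A1 a1 where gd: "A1 > 0" "a1 > 0" "\<And>x. g x \<le> A1 * exp (- a1 * norm x)"
    using log_concave_exp_decay[OF lcg assms(5)] unfolding g by auto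
  obtain f' A2 a2 where f'm[measurable]: "f' \<in> borel_measurable borel" and f'0: "\<And>x. 0 \<le> f' x"
    and ff': "AE x in lebesgue. f x = f' x" and f'c: "AE x in lborel. isCont f' x"
    and fd: "A2 > 0" "a2 > 0" "\<And>x. f' x \<le> A2 * exp (- a2 * norm x)"
    by (rule log_concave_regular_version[OF assms(1,2)]) blast
  define A where "A = max A1 A2"
  define a where "a = min a1 a2"
  have A: "A > 0" and a: "a > 0" unfolding A_def a_def using gd fd by auto
  have fA: "f' x \<le> A * exp (- a * norm x)" and gA: "g x \<le> A * exp (- a * norm x)" for x
  proof -
    have "A1 * exp (- a1 * norm x) \<le> A * exp (- a * norm x)" "A2 * exp (- a2 * norm x) \<le> A * exp (- a * norm x)"
      using gd(1) fd(1) unfolding A_def a_def by (intro mult_mono; simp add: mult_right_mono)+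
    then show "f' x \<le> A * exp (- a * norm x)" "g x \<le> A * exp (- a * norm x)"
      using gd(3)[of x] fd(3)[of x] by linarith+
  qed
  have gB: "exp (- p x) \<le> A" for x
  proof -
    have "A * exp (- a * norm x) \<le> A * 1" using A a by (intro mult_left_mono) auto
    then show ?thesis using gA[of x] unfolding g by linarith
  qed
  obtain dp where dpm[measurable]: "dp \<in> borel_measurable borel" and dp: "AE x in lborel. GDERIV p x :> dp x"
    using convex_gradient_AE[OF p] by blast
  have grad: "AE x in lebesgue. gradient_ereal \<phi> x = dp x"
    using AE_completion[OF dp]
    by eventually_elim (simp add: gradient_ereal_def gradient_eq p_def[abs_def])
  have gradg: "AE x in lebesgue. gradient g x = - exp (- p x) *\<^sub>R dp x"
    using AE_completion[OF dp]
    by eventually_elim (auto simp: g intro!: gradient_eq gderiv_exp_minus[simplified])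
  have L2: "(\<integral>\<^sup>+ x. ennreal ((norm (exp (- p x) *\<^sub>R dp x))\<^sup>2) \<partial>lborel) < \<infinity>"
  proof -
    have "(\<integral>\<^sup>+ x. ennreal ((norm (exp (- p x) *\<^sub>R dp x))\<^sup>2) \<partial>lborel) = (\<integral>\<^sup>+ x. ennreal ((norm (exp (- p x) *\<^sub>R dp x))\<^sup>2) \<partial>lebesgue)"
      by (simp add: nn_integral_completion)
    also have "\<dots> = (\<integral>\<^sup>+ x. ennreal ((norm (gradient g x))\<^sup>2) \<partial>lebesgue)"
      by (rule nn_integral_cong_AE) (use gradg in eventually_elim, simp)
    finally show ?thesis using assms(7) by simp
  qed
  have part_a: "\<exists>T\<^sub>0 \<in> SL. \<exists>z\<^sub>0. ereal (overlap f g T\<^sub>0 z\<^sub>0) = max_overlap f g"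
  proof -
    obtain S c where S: "det S = 1" and max: "\<And>S' c'. det S' = 1 \<Longrightarrow>
        (\<integral>x. f' x * g (S' *v x + c') \<partial>lborel) \<le> (\<integral>x. f' x * g (S *v x + c) \<partial>lborel)"
      using affine_overlap_maximizer[OF f'm f'0 fA gcont _ gA a] unfolding g by auto
    note opt = overlap_of_affine[OF f'm ff' gcont S, of c]
    have "max_overlap f g \<le> ereal (\<integral>x. f' x * g (S *v x + c) \<partial>lborel)"
      unfolding max_overlap_def
    proof (rule SUP_least, clarify)
      fix T :: "real^'n^'n" and z assume "T \<in> SL"
      then have "det (matrix_inv T) = 1" by (simp add: SL_def matrix_inv_det_1)
      then show "ereal (overlap f g T z) \<le> ereal (\<integral>x. f' x * g (S *v x + c) \<partial>lborel)"
        unfolding overlap_eq_affine[OF f'm ff' gcont] ereal_less_eq by (rule max)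
    qed
    then show ?thesis
      using opt matrix_inv_det_1(3)[OF S]
      by (intro bexI[of _ "matrix_inv S"] exI[of _ "- (matrix_inv S *v c)"]) (auto simp: SL_def)
  qed
  have part_b: "integrable lebesgue (\<lambda>x. (f x * g x) *\<^sub>R tensor (gradient_ereal \<phi> x) x) \<and>
      set_integrable lebesgue (supp f) (\<lambda>x. (f x * g x) *\<^sub>R gradient_ereal \<phi> x) \<and>
      set_integrable lebesgue (supp f) (\<lambda>x. (gradient_ereal \<phi> x \<bullet> x) * f x * g x) \<and>
      C_const f g \<phi> *\<^sub>R mat 1 = (LINT x|lebesgue. (f x * g x) *\<^sub>R tensor (gradient_ereal \<phi> x) x) \<and>
      0 = (LINT x:supp f|lebesgue. (f x * g x) *\<^sub>R gradient_ereal \<phi> x)"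
    if pos: "max_intersection_position f g"
  proof -
    have mx: "(\<integral>x. f' x * exp (- p (S *v x + c)) \<partial>lborel) \<le> (\<integral>x. f' x * exp (- p x) \<partial>lborel)"
      if S: "det S = 1" for S c
    proof -
      have one: "matrix_inv (mat 1 :: real^'n^'n) = mat 1"
        using matrix_inv_det_1(1)[of "mat 1 :: real^'n^'n"] by simp
      have "ereal (\<integral>x. f' x * g (S *v x + c) \<partial>lborel) \<le> max_overlap f g"
        by (rule overlap_of_affine(2)[OF f'm ff' gcont S])
      also have "\<dots> = ereal (overlap f g (mat 1) 0)" using pos by (simp add: max_intersection_position_def)
      finally show ?thesis unfolding overlap_eq_affine[OF f'm ff' gcont] one by (simp add: g)
    qed
    define M where "M = (\<integral>x. (f' x * exp (- p x)) *\<^sub>R tensor (dp x) x \<partial>lborel)"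
    note stat = affine_stationarity[OF p gB dp dpm L2 f'm f'0 fA a f'c mx, folded M_def]
    note int = gradient_moments_integrable[OF pm dpm L2 f'm f'0 fA a]
    have tr: "bounded_linear (\<lambda>X::real^'n^'n. \<Sum>i\<in>UNIV. X $ i $ i)"
      by (intro bounded_linear_sum bounded_linear_compose[OF bounded_linear_vec_nth bounded_linear_vec_nth])
    have trace: "(\<Sum>i\<in>UNIV. ((f' x * exp (- p x)) *\<^sub>R tensor (dp x) x) $ i $ i) = (dp x \<bullet> x) * f' x * exp (- p x)" for x
      by (simp add: tensor_component inner_vec_def sum_distrib_left sum_distrib_right mult_ac)
    have Sint: "integrable lborel (\<lambda>x. (dp x \<bullet> x) * f' x * exp (- p x))"
      using integrable_bounded_linear[OF tr int(1)] unfolding trace .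
    have Sval: "(\<integral>x. (dp x \<bullet> x) * f' x * exp (- p x) \<partial>lborel) = (\<Sum>i\<in>UNIV. M $ i $ i)"
      using integral_bounded_linear[OF tr int(1)] unfolding trace M_def .
    have tm: "(\<lambda>x. (f' x * exp (- p x)) *\<^sub>R tensor (dp x) x) \<in> borel_measurable borel"
      and nm: "(\<lambda>x. (f' x * exp (- p x)) *\<^sub>R dp x) \<in> borel_measurable borel"
      and sm: "(\<lambda>x. (dp x \<bullet> x) * f' x * exp (- p x)) \<in> borel_measurable borel"
      using int Sint by (auto dest: borel_measurable_integrable)
    have eT: "AE x in lebesgue. (f x * g x) *\<^sub>R tensor (gradient_ereal \<phi> x) x = (f' x * exp (- p x)) *\<^sub>R tensor (dp x) x"
      and eN: "AE x in lebesgue. (f x * g x) *\<^sub>R gradient_ereal \<phi> x = (f' x * exp (- p x)) *\<^sub>R dp x"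
      and eS: "AE x in lebesgue. (gradient_ereal \<phi> x \<bullet> x) * f x * g x = (dp x \<bullet> x) * f' x * exp (- p x)"
      using ff' grad by (eventually_elim, simp add: g)+
    have fz: "f x = 0" if "x \<notin> supp f" for x
      using that closure_subset[of "{x. f x \<noteq> 0}"] unfolding supp_def by auto
    have i1: "indicator (supp f) x *\<^sub>R ((f x * g x) *\<^sub>R gradient_ereal \<phi> x) = (f x * g x) *\<^sub>R gradient_ereal \<phi> x"
      and i2: "indicator (supp f) x *\<^sub>R ((gradient_ereal \<phi> x \<bullet> x) * f x * g x) = (gradient_ereal \<phi> x \<bullet> x) * f x * g x" for x
      using fz[of x] by (auto simp: indicator_def)
    have C: "C_const f g \<phi> = M $ i $ i" for i
    proof -
      have "(LINT x:supp f|lebesgue. (gradient_ereal \<phi> x \<bullet> x) * f x * g x) = (\<Sum>k\<in>UNIV. M $ k $ k)"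
        unfolding set_lebesgue_integral_def i2 lebesgue_integral_via_borel(2)[OF sm eS] by (rule Sval)
      also have "\<dots> = (\<Sum>k\<in>(UNIV::'n set). M $ i $ i)" by (intro sum.cong stat(3)) auto
      finally show ?thesis unfolding C_const_def by simp
    qed
    have "C_const f g \<phi> *\<^sub>R mat 1 = M"
      using C stat(2) by (simp add: vec_eq_iff mat_def)
    then show ?thesis
      unfolding set_integrable_def set_lebesgue_integral_def i1 i2
        lebesgue_integral_via_borel[OF tm eT] lebesgue_integral_via_borel[OF nm eN] lebesgue_integral_via_borel[OF sm eS]
      using int Sint stat(1) by (simp add: M_def)
  qed
  show ?thesis using part_a part_b by blast
qed

end
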